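(* Let $X(t),t\in\mathbb{Z}^d$, be a stationary max-stable rf with unit Fréchet marginals, spectral rf $Z$, spectral tail rf $\Theta$, and $Y=R\Theta$. Let $\mathcal I$ be an anchoring map with $P(\mathcal I(Y)\in\mathbb{Z}^d,\mathcal S(Y)<\infty)=P(\mathcal S(Y)<\infty)$. If $P(\mathcal S(\Theta)<\infty)>0$, then $$\theta_X=P(\mathcal I(Y)=0,\mathcal S(Y)<\infty)=P(\mathcal I_{fe}(Y)=0)=P(\mathcal I_A(\Theta)=0)=E\Big[\frac{\max_t\Theta(t)}{\sum_t\Theta(t)}\Big]=E\Big[Z(0)\frac{\max_tZ(t)}{\sum_tZ(t)}\Big]=E\Big[\frac1{\mathcal B(Y)}\Big],$$ and if moreover $\mathcal I$ is $0$-homogeneous then also $\theta_X=P(\mathcal I(\Theta)=0,\mathcal S(\Theta)<\infty)$. Furthermore, $\{\mathcal B(Y)<\infty\}=\{\mathcal S(Y)<\infty\}$ almost surely, and $\theta_X=1$ if and only if $\Theta(i)=0$ almost surely for every $i\in\mathbb{Z}^d\setminus\{0\}$. (The identity $\theta_X=E[1/\mathcal B(Y)]$ holds also without the assumption $P(\mathcal S(\Theta)<\infty)>0$.)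
   Context: $E=[0,\infty)^{\mathbb{Z}^d}$ with product $\sigma$-field; shift $(B^hf)(t)=f(t-h)$; $\mathcal S(f)=\sum_{t}f(t)$, $\mathcal B(f)=\sum_t\mathbf 1(f(t)>1)$; ratios $0/0$ and $\infty/\infty$ (and $c/\infty$) are interpreted as $0$, and $1/\infty=0$. A max-stable rf $X$ with unit Fréchet marginals has a spectral rf $Z$: non-negative, $E Z(t)=1$, $P(\sup_tZ(t)>0)=1$, with $-\ln P(X(t_i)\le x_i,i\le n)=E[\max_{i\le n}Z(t_i)/x_i]$. Its spectral tail rf $\Theta$ is given by $P(\Theta\in A)=E[Z(0)\mathbf 1(Z/Z(0)\in A)]$ ($\Theta(0)=1$ a.s.); $Y=R\Theta$ with $R$ unit Pareto ($P(R>x)=1/x$, $x\ge1$) independent of $\Theta$. Extremal index: $\theta_X=\lim_n n^{-d}E[\max_{t\in[0,n]^d\cap\mathbb{Z}^d}Z(t)]\in[0,1]$. Fix a translation-invariant total order on $\mathbb{Z}^d$ (minima below are with respect to it). An anchoring map is a measurable $\mathcal I:E\to\mathbb{Z}^d\cup\{\infty\}$ such that for all $f$ with $\mathcal I(f)\in\mathbb{Z}^d$ and all $i$: (i) $\mathcal I(f)=i$ implies $f(i)\ge\min(f(0),1)$; (ii) $\mathcal I(f)=\mathcal I(B^if)-i$. First maximum functional: $\mathcal I_A(f)=\min\{j:f(j)=\max_if(i)\}$ if $\mathcal S(f)<\infty$ and $\max_if(i)>0$, and $\mathcal I_A(f)=\infty$ otherwise. First exceedance functional: $\mathcal I_{fe}(f)=\min\{j:f(j)>1\}$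 if $\mathcal S(f)<\infty$ and $\max_if(i)>1$, and $\infty$ otherwise. $\mathcal I$ is 0-homogeneous if $\mathcal I(cf)=\mathcal I(f)$ for $c>0$. *)

theory Defs
  imports "HOL-Probability.Probability"
begin

text \<open>Random fields indexed by the lattice int^d are modelled as functions of type
  int^'d => real; the dimension d is CARD('d).\<close>

type_synonym 'd field = "int ^ 'd \<Rightarrow> real"

definition PE :: "'d::finite field measure" where
  "PE = Pi\<^sub>M UNIV (\<lambda>_. borel)"

definition shift :: "int ^ 'd \<Rightarrow> 'd::finite field \<Rightarrow> 'd field" where
  "shift h f = (\<lambda>t. f (t - h))"

definition Ssum :: "'d::finite field \<Rightarrow> ennreal" where
  "Ssum f = (\<Sum>\<^sub>\<infinity>t. ennreal (f t))"

text \<open>sup_t f(t) in [0,infinity] (a maximum whenever S(f) is finite).\<close>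
definition Mx :: "'d::finite field \<Rightarrow> ennreal" where
  "Mx f = (\<Squnion>t. ennreal (f t))"

definition Bcnt :: "'d::finite field \<Rightarrow> ennreal" where
  "Bcnt f = (if finite {t. f t > 1} then of_nat (card {t. f t > 1}) else \<top>)"

text \<open>Ratio with the conventions 0/0 = 0, c/infinity = 0 (in particular infinity/infinity = 0).\<close>
definition ratio_enn :: "ennreal \<Rightarrow> ennreal \<Rightarrow> real" where
  "ratio_enn a b = (if b = 0 \<or> b = \<top> then 0 else enn2real a / enn2real b)"

definition transl_inv_total_order :: "((int ^ 'd::finite) \<times> (int ^ 'd)) set \<Rightarrow> bool" where
  "transl_inv_total_order r \<longleftrightarrow> linear_order r \<and>
     (\<forall>i j h. (i, j) \<in> r \<longleftrightarrow> (i + h, j + h) \<in> r)"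

definition ord_min :: "((int ^ 'd::finite) \<times> (int ^ 'd)) set \<Rightarrow> (int ^ 'd) set \<Rightarrow> int ^ 'd" where
  "ord_min r A = (THE j. j \<in> A \<and> (\<forall>i\<in>A. (j, i) \<in> r))"

text \<open>Anchoring maps; None plays the role of the point infinity.\<close>
definition anchoring_map :: "('d::finite field \<Rightarrow> (int ^ 'd) option) \<Rightarrow> bool" where
  "anchoring_map I \<longleftrightarrow> I \<in> measurable PE (count_space UNIV) \<and>
     (\<forall>f j i. (\<forall>t. 0 \<le> f t) \<longrightarrow> I f = Some j \<longrightarrow>
        f j \<ge> min (f 0) 1 \<and> I (shift i f) = Some (j + i))"

definition zero_homogeneous :: "('d::finite field \<Rightarrow> (int ^ 'd) option) \<Rightarrow> bool" where
  "zero_homogeneous I \<longleftrightarrow> (\<forall>f (c::real). (\<forall>t. 0 \<le> f t) \<longrightarrow> c > 0 \<longrightarrow> I (\<lambda>t. c * f t) = I f)"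

definition IA :: "((int ^ 'd::finite) \<times> (int ^ 'd)) set \<Rightarrow> 'd field \<Rightarrow> (int ^ 'd) option" where
  "IA r f = (if Ssum f < \<top> \<and> (\<exists>t. f t > 0)
             then Some (ord_min r {j. \<forall>i. f i \<le> f j}) else None)"

definition Ife :: "((int ^ 'd::finite) \<times> (int ^ 'd)) set \<Rightarrow> 'd field \<Rightarrow> (int ^ 'd) option" where
  "Ife r f = (if Ssum f < \<top> \<and> (\<exists>t. f t > 1)
              then Some (ord_min r {j. f j > 1}) else None)"

definition stationary :: "'a measure \<Rightarrow> ('a \<Rightarrow> 'd::finite field) \<Rightarrow> bool" where
  "stationary M X \<longleftrightarrow> X \<in> measurable M PE \<and>
     (\<forall>h. distr M PE (\<lambda>\<omega>. shift h (X \<omega>)) = distr M PE X)"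

definition spectral_rf :: "'a measure \<Rightarrow> ('a \<Rightarrow> 'd::finite field) \<Rightarrow> ('a \<Rightarrow> 'd field) \<Rightarrow> bool" where
  "spectral_rf M X Z \<longleftrightarrow>
     X \<in> measurable M PE \<and> Z \<in> measurable M PE \<and>
     (\<forall>\<omega>\<in>space M. \<forall>t. 0 \<le> Z \<omega> t) \<and>
     (\<forall>t. integrable M (\<lambda>\<omega>. Z \<omega> t) \<and> (\<integral>\<omega>. Z \<omega> t \<partial>M) = 1) \<and>
     (AE \<omega> in M. \<exists>t. 0 < Z \<omega> t) \<and>
     (\<forall>T x. finite T \<longrightarrow> T \<noteq> {} \<longrightarrow> (\<forall>t\<in>T. 0 < x t) \<longrightarrow>
        measure M {\<omega>\<in>space M. \<forall>t\<in>T. X \<omega> t \<le> x t}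
          = exp (- (\<integral>\<omega>. Max ((\<lambda>t. Z \<omega> t / x t) ` T) \<partial>M)))"

definition spectral_tail :: "'a measure \<Rightarrow> ('a \<Rightarrow> 'd::finite field) \<Rightarrow> ('a \<Rightarrow> 'd field) \<Rightarrow> bool" where
  "spectral_tail M Z Th \<longleftrightarrow> Th \<in> measurable M PE \<and>
     (\<forall>A\<in>sets PE. measure M {\<omega>\<in>space M. Th \<omega> \<in> A}
        = (\<integral>\<omega>. Z \<omega> 0 * indicator A (\<lambda>t. Z \<omega> t / Z \<omega> 0) \<partial>M))"

definition unit_pareto :: "'a measure \<Rightarrow> ('a \<Rightarrow> real) \<Rightarrow> bool" where
  "unit_pareto M R \<longleftrightarrow> R \<in> borel_measurable M \<and>
     (\<forall>x\<ge>1. measure M {\<omega>\<in>space M. R \<omega> > x} = 1 / x)"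

definition cube :: "nat \<Rightarrow> (int ^ 'd::finite) set" where
  "cube n = {t. \<forall>i. 0 \<le> t $ i \<and> t $ i \<le> int n}"

text \<open>The sequence n^{-d} E[max_{t in [0,n]^d} Z(t)] whose limit is the extremal index.\<close>
definition ext_seq :: "'a measure \<Rightarrow> ('a \<Rightarrow> 'd::finite field) \<Rightarrow> nat \<Rightarrow> real" where
  "ext_seq M Z n = (\<integral>\<omega>. Max ((\<lambda>t. Z \<omega> t) ` cube n) \<partial>M) / real n ^ CARD('d)"

end

theory Submission
  imports Defs
begin

text \<open>
  Let \<open>\<nu>\<close> be the image of \<open>P \<otimes> z\<^sup>-\<^sup>2 dz\<close> under \<open>(\<omega>, z) \<mapsto> z Z(\<omega>)\<close>. The sets on which some
  coordinate of a finite family reaches a positive level have \<open>\<nu>\<close>-measure \<open>E max Z(t)/x(t)\<close>, so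
  stationarity of \<open>X\<close> makes \<open>\<nu>\<close> shift invariant, and \<open>Y\<close> has law \<open>\<nu>\<close> restricted to \<open>f(0) > 1\<close>.

  Spreading unit mass evenly over the exceedances in \<open>[0,n]\<^sup>d\<close> writes \<open>E max Z\<close> over the cube as a sum of
  terms \<open>E[1 / #{s \<in> [0,n]\<^sup>d - t : Y(s) > 1}]\<close>, whose averages converge to \<open>E[1/B(Y)]\<close>.

  Shift invariance also gives the mass transport identity
  \<open>\<integral> w(f) \<Sum>\<^sub>t v(B\<^sup>t f) d\<nu> = \<integral> v(f) \<Sum>\<^sub>t w(B\<^sup>t f) d\<nu>\<close>. Hence all weights \<open>w\<close> that sum to the indicator of
  \<open>S < \<infinity>, max > 1\<close> along every orbit have the same integral. Anchoring maps,
  \<open>1(f(0) > 1)/B(f)\<close> and \<open>f(0)/S(f) 1(max f > 1)\<close> are such weights; integrating the last one over \<open>z\<close>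
  produces \<open>E[Z(0) max Z/\<Sum> Z]\<close>. That \<open>B < \<infinity>\<close> forces \<open>S < \<infinity>\<close> is the same identity with \<open>v(f) = f(0)\<close> and
  \<open>w(f) = 1(f(0) > 1)/(B(f) max f)\<close>: the right-hand side is at most \<open>E Z(0) = 1\<close>. Finally, \<open>\<theta> = 1\<close> means
  \<open>max \<Theta> = \<Sum> \<Theta>\<close> almost surely, and \<open>\<Theta>(0) = 1\<close>.
\<close>

section \<open>Fields and their orbits\<close>

lemma infsum_eq_nn_integral_count_space:
  fixes g :: "'b::countable \<Rightarrow> ennreal"
  shows "(\<Sum>\<^sub>\<infinity>t. g t) = (\<integral>\<^sup>+t. g t \<partial>count_space UNIV)"
proof -
  define initial :: "nat \<Rightarrow> 'b set" where "initial n = {t. to_nat t < n}" for n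
  have finite_initial: "finite (initial n)" for n
    unfolding initial_def by (rule finite_imageD[of to_nat])
      (auto intro: finite_subset[of _ "{..<n}"] inj_on_subset[OF inj_to_nat])
  have sum_eq: "sum g F = emeasure (density (count_space UNIV) g) F" if "finite F" for F
    using that by (simp add: emeasure_density nn_integral_count_space_finite
        flip: nn_integral_count_space_indicator)
  have "(\<Sum>\<^sub>\<infinity>t. g t) = (\<Squnion>F\<in>{F. finite F \<and> F \<subseteq> UNIV}. sum g F)"
    by (rule nonneg_infsum_complete) simp
  also have "\<dots> = emeasure (density (count_space UNIV) g) UNIV"
  proof (intro antisym SUP_least)
    show "sum g F \<le> emeasure (density (count_space UNIV) g) UNIV"
      if "F \<in> {F. finite F \<and> F \<subseteq> UNIV}" for F
      using that by (auto simp: sum_eq intro!: emeasure_mono)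
    have "emeasure (density (count_space UNIV) g) UNIV
        = (\<Squnion>n. emeasure (density (count_space UNIV) g) (initial n))"
      by (subst SUP_emeasure_incseq) (auto simp: initial_def incseq_def intro!: arg_cong2[where f = emeasure])
    also have "\<dots> \<le> (\<Squnion>F\<in>{F. finite F \<and> F \<subseteq> UNIV}. sum g F)"
      by (rule SUP_mono) (use finite_initial in \<open>auto simp flip: sum_eq\<close>)
    finally show "emeasure (density (count_space UNIV) g) UNIV
        \<le> (\<Squnion>F\<in>{F. finite F \<and> F \<subseteq> UNIV}. sum g F)" .
  qed
  finally show ?thesis by (simp add: emeasure_density)
qed

lemma borel_measurable_nn_integral_count_space:
  fixes g :: "'b::countable \<Rightarrow> 'c \<Rightarrow> ennreal"
  assumes [measurable]: "\<And>t. g t \<in> borel_measurable N"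
  shows "(\<lambda>x. \<integral>\<^sup>+t. g t x \<partial>count_space UNIV) \<in> borel_measurable N"
  by (rule sigma_finite_measure.borel_measurable_nn_integral[OF sigma_finite_measure_count_space]) measurable

lemma nn_integral_count_space_translate:
  fixes g :: "'b::group_add \<Rightarrow> ennreal"
  shows "(\<integral>\<^sup>+t. g (t - h) \<partial>count_space UNIV) = (\<integral>\<^sup>+t. g t \<partial>count_space UNIV)"
  by (rule nn_integral_bij_count_space) (rule bij_betwI[where g = "\<lambda>t. t + h"], auto)

lemma nn_integral_count_space_uminus:
  fixes g :: "'b::group_add \<Rightarrow> ennreal"
  shows "(\<integral>\<^sup>+t. g (- t) \<partial>count_space UNIV) = (\<integral>\<^sup>+t. g t \<partial>count_space UNIV)"
  by (rule nn_integral_bij_count_space) (rule bij_uminus)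

lemma space_PE [simp]: "space (PE :: 'd::finite field measure) = UNIV"
  by (simp add: PE_def space_PiM)

lemma measurable_PE_coord [measurable (raw)]:
  "(\<lambda>f. f t) \<in> borel_measurable (PE :: 'd::finite field measure)"
  unfolding PE_def by measurable

lemma measurable_PEI:
  fixes g :: "'a \<Rightarrow> 'd::finite field"
  assumes "\<And>t. (\<lambda>\<omega>. g \<omega> t) \<in> borel_measurable N"
  shows "g \<in> measurable N PE"
  unfolding PE_def by (rule measurable_PiM_single') (use assms in auto)

lemma measurable_PE_coord_compose:
  "g \<in> measurable N (PE :: 'd::finite field measure) \<Longrightarrow> (\<lambda>\<omega>. g \<omega> t) \<in> borel_measurable N"
  by (rule measurable_compose[OF _ measurable_PE_coord])

lemma Collect_in_sets_PE: "Measurable.pred PE Q \<Longrightarrow> {f. Q f} \<in> sets PE"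
  by (simp add: pred_def)

lemma measurable_shift [measurable]: "shift h \<in> measurable PE (PE :: 'd::finite field measure)"
  by (rule measurable_PEI) (simp add: shift_def)

lemma shift_shift [simp]: "shift h (shift k f) = shift (h + k) f"
  by (auto simp: shift_def fun_eq_iff algebra_simps)

lemma shift_0 [simp]: "shift 0 f = f"
  by (simp add: shift_def)

lemma shift_nonneg: "\<forall>t. 0 \<le> f t \<Longrightarrow> \<forall>t. 0 \<le> shift h f t"
  by (simp add: shift_def)

lemma shift_at_0 [simp]: "shift t f 0 = f (- t)"
  by (simp add: shift_def)

definition orbit_sum :: "('d::finite field \<Rightarrow> ennreal) \<Rightarrow> 'd field \<Rightarrow> ennreal" where
  "orbit_sum w f = (\<integral>\<^sup>+t. w (shift t f) \<partial>count_space UNIV)"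

lemma measurable_orbit_sum [measurable]:
  fixes w :: "'d::finite field \<Rightarrow> ennreal"
  assumes [measurable]: "w \<in> borel_measurable PE"
  shows "orbit_sum w \<in> borel_measurable PE"
  unfolding orbit_sum_def[abs_def] by (rule borel_measurable_nn_integral_count_space) measurable

lemma orbit_sum_coord: "orbit_sum (\<lambda>f. g (f 0)) f = (\<integral>\<^sup>+t. g (f t) \<partial>count_space UNIV)"
  using nn_integral_count_space_uminus[of "\<lambda>t. g (f t)"] by (simp add: orbit_sum_def)

lemma orbit_sum_shift [simp]: "orbit_sum w (shift h f) = orbit_sum w f"
  using nn_integral_count_space_translate[of "\<lambda>t. w (shift t f)" "- h"] by (simp add: orbit_sum_def)

lemma le_orbit_sum: "w f \<le> orbit_sum w f"
  using nn_integral_ge_point[of 0 UNIV "\<lambda>t. w (shift t f)"] by (simp add: orbit_sum_def)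

lemma orbit_sum_mult_invariant:
  assumes "\<And>t. g (shift t f) = g f"
  shows "orbit_sum (\<lambda>f. w f * g f) f = orbit_sum w f * g f"
  by (simp add: orbit_sum_def assms nn_integral_multc)

lemma orbit_sum_normalized:
  "orbit_sum (\<lambda>f. w f / orbit_sum w f) f = indicator {f. 0 < orbit_sum w f \<and> orbit_sum w f < \<top>} f"
proof -
  have "orbit_sum (\<lambda>f. w f / orbit_sum w f) f = orbit_sum w f / orbit_sum w f"
    unfolding divide_ennreal_def by (rule orbit_sum_mult_invariant) simp
  also have "\<dots> = indicator {f. 0 < orbit_sum w f \<and> orbit_sum w f < \<top>} f"
    \<comment> \<open>on \<^typ>\<open>ennreal\<close> both \<open>0 / 0\<close> and \<open>\<top> / \<top>\<close> are \<open>0\<close>\<close>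
    by (auto simp: indicator_def top.not_eq_extremum zero_less_iff_neq_zero)
  finally show ?thesis .
qed

section \<open>Sums, maxima and exceedances\<close>

definition exceedances :: "'d::finite field \<Rightarrow> (int ^ 'd) set" where
  "exceedances f = {t. 1 < f t}"

definition exceedance_count :: "(int ^ 'd::finite) set \<Rightarrow> 'd field \<Rightarrow> ennreal" where
  "exceedance_count D f = emeasure (count_space UNIV) (exceedances f \<inter> D)"

lemma exceedance_count_eq_nn_integral:
  "exceedance_count D f = (\<integral>\<^sup>+t. indicator {1<..} (f t) * indicator D t \<partial>count_space UNIV)"
proof -
  have "exceedance_count D f = (\<integral>\<^sup>+t. indicator (exceedances f \<inter> D) t \<partial>count_space UNIV)"
    by (simp add: exceedance_count_def)
  also have "\<dots> = (\<integral>\<^sup>+t. indicator {1<..} (f t) * indicator D t \<partial>count_space UNIV)"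
    by (intro nn_integral_cong) (auto simp: exceedances_def indicator_def)
  finally show ?thesis .
qed

lemma exceedance_count_finite:
  "finite D \<Longrightarrow> exceedance_count D f = (\<Sum>t\<in>D. indicator {1<..} (f t))"
  by (simp add: exceedance_count_eq_nn_integral nn_integral_count_space_finite
      flip: nn_integral_count_space_indicator)

lemma measurable_exceedance_count [measurable]:
  "exceedance_count D \<in> borel_measurable (PE :: 'd::finite field measure)"
  unfolding exceedance_count_eq_nn_integral[abs_def]
  by (rule borel_measurable_nn_integral_count_space) measurable

lemma exceedance_count_mono: "C \<subseteq> D \<Longrightarrow> exceedance_count C f \<le> exceedance_count D f"
  unfolding exceedance_count_def by (intro emeasure_mono) auto

lemma exceedance_count_ge_1: "t \<in> D \<Longrightarrow> 1 < f t \<Longrightarrow> 1 \<le> exceedance_count D f"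
  using emeasure_mono[of "{t}" "exceedances f \<inter> D" "count_space UNIV"]
  by (simp add: exceedance_count_def exceedances_def)

lemma exceedance_count_eq_0_iff: "exceedance_count D f = 0 \<longleftrightarrow> (\<forall>t\<in>D. f t \<le> 1)"
proof -
  have "exceedance_count D f = 0 \<longleftrightarrow> exceedances f \<inter> D = {}"
    by (simp add: exceedance_count_def emeasure_count_space_eq_0)
  then show ?thesis by (auto simp: exceedances_def disjoint_iff not_less)
qed

lemma exceedance_count_shift: "exceedance_count D (shift h f) = exceedance_count ((\<lambda>t. t - h) ` D) f"
proof -
  have "indicator D t = (indicator ((\<lambda>t. t - h) ` D) (t - h) :: ennreal)" for t
    by (auto simp: indicator_def)
  then show ?thesis
    using nn_integral_count_space_translate[of "\<lambda>t. indicator {1<..} (f t) * indicator ((\<lambda>t. t - h) ` D) t" h]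
    by (simp add: exceedance_count_eq_nn_integral shift_def)
qed

lemma Ssum_eq_nn_integral: "Ssum f = (\<integral>\<^sup>+t. ennreal (f t) \<partial>count_space UNIV)"
  by (simp add: Ssum_def infsum_eq_nn_integral_count_space)

lemma Ssum_eq_orbit_sum: "Ssum = orbit_sum (\<lambda>f. ennreal (f 0))"
  by (auto simp: Ssum_eq_nn_integral orbit_sum_coord)

lemma Bcnt_eq_exceedance_count: "Bcnt = exceedance_count UNIV"
  by (auto simp: Bcnt_def exceedance_count_def exceedances_def)

lemma Bcnt_eq_orbit_sum: "Bcnt = orbit_sum (\<lambda>f. indicator {1<..} (f 0))"
  by (auto simp: Bcnt_eq_exceedance_count exceedance_count_eq_nn_integral orbit_sum_coord)

lemma measurable_Ssum [measurable]: "Ssum \<in> borel_measurable (PE :: 'd::finite field measure)"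
  unfolding Ssum_eq_orbit_sum by measurable

lemma measurable_Bcnt [measurable]: "Bcnt \<in> borel_measurable (PE :: 'd::finite field measure)"
  unfolding Bcnt_eq_exceedance_count by measurable

lemma measurable_Mx [measurable]: "Mx \<in> borel_measurable (PE :: 'd::finite field measure)"
  unfolding Mx_def[abs_def] by (rule borel_measurable_SUP) auto

lemma measurable_ratio_enn [measurable (raw)]:
  assumes [measurable]: "a \<in> borel_measurable N" "b \<in> borel_measurable N"
  shows "(\<lambda>x. ratio_enn (a x) (b x)) \<in> borel_measurable N"
  unfolding ratio_enn_def by measurable

lemma Ssum_shift [simp]: "Ssum (shift h f) = Ssum f"
  by (simp add: Ssum_eq_orbit_sum)

lemma Bcnt_shift [simp]: "Bcnt (shift h f) = Bcnt f"
  by (simp add: Bcnt_eq_orbit_sum)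

lemma Mx_shift [simp]: "Mx (shift h f) = Mx f"
proof -
  have "range (\<lambda>t. ennreal (f (t - h))) = range (\<lambda>t. ennreal (f t))"
    using image_comp[of "\<lambda>t. ennreal (f t)" "\<lambda>t. t - h" UNIV] by (simp add: comp_def surj_diff_right)
  then show ?thesis by (simp add: Mx_def shift_def)
qed

lemma Mx_scale: "0 \<le> c \<Longrightarrow> Mx (\<lambda>t. c * f t) = ennreal c * Mx f"
  unfolding Mx_def by (simp add: ennreal_mult' SUP_mult_left_ennreal)

lemma Ssum_scale: "0 \<le> c \<Longrightarrow> Ssum (\<lambda>t. c * f t) = ennreal c * Ssum f"
  unfolding Ssum_eq_nn_integral by (simp add: ennreal_mult' nn_integral_cmult)

lemma Ssum_scale_finite_iff: "0 < c \<Longrightarrow> Ssum (\<lambda>t. c * f t) < \<top> \<longleftrightarrow> Ssum f < \<top>"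
  by (auto simp: Ssum_scale ennreal_mult_less_top ennreal_mult_top)

lemma Mx_upper: "ennreal (f t) \<le> Mx f"
  unfolding Mx_def by (rule SUP_upper) simp

lemma Mx_gt_1_iff: "1 < Mx f \<longleftrightarrow> (\<exists>t. 1 < f t)"
  by (simp add: Mx_def less_SUP_iff)

lemma Mx_le_Ssum: "Mx f \<le> Ssum f"
  unfolding Mx_def Ssum_eq_nn_integral
  by (rule SUP_least) (rule nn_integral_ge_point, simp)

lemma sum_le_Ssum: "finite F \<Longrightarrow> (\<Sum>t\<in>F. ennreal (f t)) \<le> Ssum f"
  unfolding Ssum_def by (subst nonneg_infsum_complete) (auto intro!: SUP_upper)

lemma Mx_add_min_le_Ssum:
  assumes "s \<noteq> t"
  shows "Mx f + ennreal (min (f s) (f t)) \<le> Ssum f"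
proof -
  have "ennreal (f u) + ennreal (min (f s) (f t)) \<le> Ssum f" for u
  proof -
    define v where "v = (if u = s then t else s)"
    then have "u \<noteq> v" "min (f s) (f t) \<le> f v" using assms by auto
    then have "ennreal (f u) + ennreal (min (f s) (f t)) \<le> (\<Sum>i\<in>{u, v}. ennreal (f i))"
      by (simp add: add_left_mono ennreal_leI)
    also have "\<dots> \<le> Ssum f"
      by (rule sum_le_Ssum) simp
    finally show ?thesis .
  qed
  then show ?thesis
    unfolding Mx_def by (subst ennreal_SUP_add_left[symmetric]) (auto intro: SUP_least)
qed

lemma Ssum_single:
  assumes "\<And>t. t \<noteq> s \<Longrightarrow> f t = 0"
  shows "Ssum f = ennreal (f s)"
proof -
  have "Ssum f = (\<integral>\<^sup>+t. ennreal (f s) * indicator {s} t \<partial>count_space UNIV)"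
    unfolding Ssum_eq_nn_integral using assms by (intro nn_integral_cong) (auto simp: indicator_def)
  then show ?thesis
    by (simp add: nn_integral_cmult_indicator)
qed

lemma Bcnt_pos_iff: "0 < Bcnt f \<longleftrightarrow> 1 < Mx f"
  using exceedance_count_eq_0_iff[of UNIV f]
  by (auto simp: Bcnt_eq_exceedance_count Mx_gt_1_iff zero_less_iff_neq_zero not_le)

lemma finite_level_set_if_Ssum_finite:
  assumes "Ssum f < \<top>" "0 < c"
  shows "finite {t. c \<le> f t}"
proof -
  have "emeasure (count_space UNIV) {t\<in>UNIV. 1 \<le> ennreal (1 / c) * ennreal (f t)} \<le> ennreal (1 / c) * Ssum f"
    using nn_integral_Markov_inequality[of "\<lambda>t. ennreal (f t)" UNIV "count_space UNIV" "ennreal (1 / c)"]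
    by (simp add: Ssum_eq_nn_integral)
  also have "\<dots> < \<top>"
    using assms by (simp add: ennreal_mult_less_top)
  also have "{t\<in>UNIV. 1 \<le> ennreal (1 / c) * ennreal (f t)} = {t. c \<le> f t}"
  proof -
    have "1 \<le> ennreal (1 / c) * ennreal (f t) \<longleftrightarrow> c \<le> f t" for t
    proof -
      have "1 \<le> ennreal (1 / c) * ennreal (f t) \<longleftrightarrow> 1 \<le> 1 / c * f t"
        using assms(2) by (simp flip: ennreal_mult')
      also have "\<dots> \<longleftrightarrow> c \<le> f t"
        using assms(2) by (auto simp: field_simps)
      finally show ?thesis .
    qed
    then show ?thesis by simp
  qed
  finally show ?thesis by (simp add: emeasure_count_space split: if_splits)
qed

lemma Bcnt_finite_if_Ssum_finite:
  assumes "Ssum f < \<top>" shows "Bcnt f < \<top>"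
proof -
  have "finite {t. 1 < f t}"
    by (rule finite_subset[OF _ finite_level_set_if_Ssum_finite[OF assms zero_less_one]]) auto
  then show ?thesis by (simp add: Bcnt_def less_top[symmetric])
qed

lemma Mx_finite_if_Bcnt_finite:
  assumes "Bcnt f < \<top>" shows "Mx f < \<top>"
proof -
  have finite_exceedances: "finite (exceedances f)"
    using assms by (auto simp: Bcnt_def exceedances_def split: if_splits)
  define c where "c = Max (insert 1 (f ` exceedances f))"
  have "f t \<le> c" for t
    unfolding c_def using finite_exceedances
    by (cases "1 < f t") (auto intro!: Max_ge simp: Max_ge_iff exceedances_def)
  then have "Mx f \<le> ennreal c"
    unfolding Mx_def by (intro SUP_least ennreal_leI) auto
  then show ?thesis by (auto simp: less_top[symmetric] top_unique)
qed

lemma ennreal_scale_divide: "0 < c \<Longrightarrow> ennreal c * a / (ennreal c * b) = a / b"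
  using divide_mult_eq[of "ennreal c" a b] by (simp add: mult.commute)

lemma ennreal_divide_times_self_le: "a / b * b \<le> (a :: ennreal)"
  by (cases "b = 0 \<or> b = \<top>") (auto simp: ennreal_divide_times top.not_eq_extremum)

lemma ratio_enn_nonneg: "0 \<le> ratio_enn a b"
  by (simp add: ratio_enn_def)

lemma ennreal_ratio_enn:
  assumes "a < \<top>" "0 < b"
  shows "ennreal (ratio_enn a b) = a / b"
  using assms
  by (cases a; cases b) (auto simp: ratio_enn_def divide_ennreal less_top[symmetric])

lemma ennreal_mass_share:
  assumes "0 \<le> f t"
  shows "ennreal (f t * ratio_enn (Mx f) (Ssum f)) = ennreal (f t) / Ssum f * Mx f"
proof (cases "Ssum f = \<top> \<or> Ssum f = 0")
  case True
  then show ?thesis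
    using Mx_le_Ssum[of f] by (auto simp: ratio_enn_def)
next
  case False
  then have "Mx f < \<top>" "0 < Ssum f"
    using Mx_le_Ssum[of f] by (auto simp: zero_less_iff_neq_zero less_top intro: le_less_trans)
  then show ?thesis
    using assms by (simp add: ennreal_mult ratio_enn_nonneg ennreal_ratio_enn ennreal_divide_times)
qed

lemma ratio_enn_le_1: "a \<le> b \<Longrightarrow> ratio_enn a b \<le> 1"
  by (cases a; cases b) (auto simp: ratio_enn_def divide_le_eq_1 top_unique)

lemma ratio_enn_eq_1D:
  assumes "ratio_enn a b = 1" "a \<le> b"
  shows "a = b" "b \<noteq> \<top>"
proof -
  have "b \<noteq> 0" and b: "b \<noteq> \<top>"
    using assms(1) by (simp_all add: ratio_enn_def split: if_splits)
  then have "enn2real a = enn2real b"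
    using assms(1) by (simp add: ratio_enn_def)
  moreover have "a \<noteq> \<top>"
    using assms(2) b by (metis top_unique)
  ultimately show "a = b" "b \<noteq> \<top>"
    using ennreal_enn2real_if[of a] ennreal_enn2real_if[of b] b by metis+
qed

lemma ratio_enn_Mx_Ssum_eq_1_iff:
  assumes nonneg: "\<forall>t. 0 \<le> f t" and "0 < f s"
  shows "ratio_enn (Mx f) (Ssum f) = 1 \<longleftrightarrow> (\<forall>t. t \<noteq> s \<longrightarrow> f t = 0)"
proof
  assume "ratio_enn (Mx f) (Ssum f) = 1"
  from ratio_enn_eq_1D[OF this Mx_le_Ssum]
  have "Mx f = Ssum f" "Ssum f \<noteq> \<top>" .
  show "\<forall>t. t \<noteq> s \<longrightarrow> f t = 0"
  proof (intro allI impI)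
    fix t assume "t \<noteq> s"
    then have "ennreal (min (f s) (f t)) = 0"
      using Mx_add_min_le_Ssum[of s t f] \<open>Mx f = Ssum f\<close> \<open>Ssum f \<noteq> \<top>\<close>
        ennreal_add_left_cancel_le[of "Ssum f" _ 0] by simp
    then have "f t \<le> 0"
      using \<open>0 < f s\<close> by (simp add: ennreal_eq_0_iff min_le_iff_disj)
    with nonneg show "f t = 0"
      by (simp add: antisym)
  qed
next
  assume "\<forall>t. t \<noteq> s \<longrightarrow> f t = 0"
  then have "Ssum f = ennreal (f s)"
    by (intro Ssum_single) simp
  moreover from this have "Mx f = ennreal (f s)"
    using Mx_le_Ssum[of f] Mx_upper[of f s] by simp
  ultimately show "ratio_enn (Mx f) (Ssum f) = 1"
    using \<open>0 < f s\<close> by (simp add: ratio_enn_def)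
qed

lemma ratio_enn_1_antimono:
  assumes "a \<le> b" "1 \<le> a"
  shows "ratio_enn 1 b \<le> ratio_enn 1 a"
  using assms by (cases a; cases b) (auto simp: ratio_enn_def top_unique frac_le)

lemma ratio_enn_scale:
  assumes "0 < c"
  shows "ratio_enn (ennreal c * a) (ennreal c * b) = ratio_enn a b"
  using assms by (auto simp: ratio_enn_def enn2real_mult ennreal_mult_eq_top_iff)

lemma ratio_enn_1_eq_enn2real_inverse: "ratio_enn 1 b = enn2real (inverse b)"
  by (cases b) (auto simp: ratio_enn_def inverse_ennreal inverse_eq_divide)

lemma tendsto_ratio_enn_1:
  assumes "(u \<longlongrightarrow> l) F" "1 \<le> l"
  shows "((\<lambda>k. ratio_enn 1 (u k)) \<longlongrightarrow> ratio_enn 1 l) F"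
proof -
  have "((\<lambda>k. inverse (u k)) \<longlongrightarrow> inverse l) F"
    using continuous_on_inverse_ennreal[OF continuous_on_id, of UNIV] assms(1)
    by (rule continuous_on_tendsto_compose) auto
  moreover have "inverse l = ennreal (enn2real (inverse l))"
    using assms(2) by (subst ennreal_enn2real) (auto simp: top.not_eq_extremum[symmetric])
  ultimately show ?thesis
    unfolding ratio_enn_1_eq_enn2real_inverse by (metis tendsto_enn2real enn2real_nonneg)
qed

section \<open>Lattice boxes\<close>

definition int_box :: "int \<Rightarrow> int \<Rightarrow> (int ^ 'd::finite) set" where
  "int_box a b = {t. \<forall>i. a \<le> t $ i \<and> t $ i \<le> b}"

lemma finite_int_box: "finite (int_box a b :: (int ^ 'd::finite) set)"
  and card_int_box: "card (int_box a b :: (int ^ 'd::finite) set) = nat (b - a + 1) ^ CARD('d)"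
proof -
  have bij: "bij_betw vec_nth (int_box a b) (Pi\<^sub>E UNIV (\<lambda>_::'d. {a..b}))"
    by (rule bij_betwI[where g = vec_lambda]) (auto simp: int_box_def)
  have "finite (Pi\<^sub>E UNIV (\<lambda>_::'d. {a..b}))"
    by (intro finite_PiE) auto
  then show "finite (int_box a b :: (int ^ 'd) set)"
    using bij_betw_finite[OF bij] by simp
  show "card (int_box a b :: (int ^ 'd) set) = nat (b - a + 1) ^ CARD('d)"
    using bij_betw_same_card[OF bij] by (simp add: card_PiE)
qed

lemma int_box_mono: "c \<le> a \<Longrightarrow> b \<le> d \<Longrightarrow> int_box a b \<subseteq> int_box c d"
  by (auto simp: int_box_def intro: order_trans)

lemma int_box_add: "s \<in> int_box a b \<Longrightarrow> t \<in> int_box c d \<Longrightarrow> s + t \<in> int_box (a + c) (b + d)"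
  by (simp add: int_box_def add_mono)

lemma UN_int_box: "(\<Union>k. int_box (- int k) (int k)) = (UNIV :: (int ^ 'd::finite) set)"
proof (intro equalityI subsetI UNIV_I)
  fix t :: "int ^ 'd"
  define k where "k = nat (Max (range (\<lambda>i. \<bar>t $ i\<bar>)))"
  have "\<bar>t $ i\<bar> \<le> int k" for i
  proof -
    have "\<bar>t $ i\<bar> \<le> Max (range (\<lambda>i. \<bar>t $ i\<bar>))" by (rule Max_ge) auto
    then show ?thesis unfolding k_def by linarith
  qed
  then have "t \<in> int_box (- int k) (int k)"
    by (simp add: int_box_def abs_le_iff minus_le_iff)
  then show "t \<in> (\<Union>k. int_box (- int k) (int k))" by blast
qed

lemma cube_eq_int_box: "cube n = int_box 0 (int n)"
  by (simp add: cube_def int_box_def)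

lemma int_box_density_tendsto:
  "(\<lambda>n. real (card (int_box a (int n - b) :: (int ^ 'd::finite) set)) / real n ^ CARD('d)) \<longlonglongrightarrow> 1"
proof -
  have "(\<lambda>n. real (nat (int n - b - a + 1)) / real n) \<longlonglongrightarrow> 1"
  proof (rule Lim_transform_eventually)
    show "(\<lambda>n. 1 + real_of_int (1 - a - b) / real n) \<longlonglongrightarrow> 1"
      by (rule tendsto_eq_intros lim_const_over_n refl | simp)+
    show "\<forall>\<^sub>F n in sequentially. 1 + real_of_int (1 - a - b) / real n = real (nat (int n - b - a + 1)) / real n"
      using eventually_ge_at_top[of "Suc (nat (a + b))"]
      by eventually_elim (auto simp: field_simps)
  qed
  from tendsto_power[OF this, of "CARD('d)"] show ?thesis
    by (simp add: card_int_box power_divide)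
qed

section \<open>Shift-invariant tail measures\<close>

definition summable_clusters :: "'d::finite field set" where
  "summable_clusters = {f. 1 < Mx f \<and> Ssum f < \<top>}"

locale tail_measure =
  fixes \<nu> :: "'d::finite field measure"
  assumes sets_eq_PE [measurable_cong]: "sets \<nu> = sets PE"
    and distr_shift: "\<And>h. distr \<nu> PE (shift h) = \<nu>"
    and AE_nonneg: "AE f in \<nu>. \<forall>t. 0 \<le> f t"
    and AE_neq_1_at_0: "AE f in \<nu>. f 0 \<noteq> 1"
    and emeasure_exceedance_at_0: "emeasure \<nu> {f. 1 < f 0} = 1"
    and peak_share_finite: "(\<integral>\<^sup>+f. ennreal (f 0) / Mx f * indicator {f. 1 < Mx f} f \<partial>\<nu>) < \<top>"
begin

lemma space_eq_UNIV [simp]: "space \<nu> = UNIV"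
  using sets_eq_imp_space_eq[OF sets_eq_PE] by simp

lemma nn_integral_shift:
  assumes "F \<in> borel_measurable PE"
  shows "(\<integral>\<^sup>+f. F (shift h f) \<partial>\<nu>) = (\<integral>\<^sup>+f. F f \<partial>\<nu>)"
proof -
  have "(\<integral>\<^sup>+f. F f \<partial>\<nu>) = (\<integral>\<^sup>+f. F f \<partial>distr \<nu> PE (shift h))"
    by (simp add: distr_shift)
  also have "\<dots> = (\<integral>\<^sup>+f. F (shift h f) \<partial>\<nu>)"
    using assms by (intro nn_integral_distr) measurable
  finally show ?thesis ..
qed

lemma AE_shift:
  assumes "AE f in \<nu>. Q f"
  shows "AE f in \<nu>. \<forall>h. Q (shift h f)"
proof -
  have "AE f in \<nu>. Q (shift h f)" for h
  proof (rule AE_distrD[where P = Q and M' = PE])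
    show "shift h \<in> measurable \<nu> PE" by measurable
    show "AE f in distr \<nu> PE (shift h). Q f" by (subst distr_shift) (rule assms)
  qed
  then show ?thesis by (simp add: AE_all_countable)
qed

lemma mass_transport:
  assumes [measurable]: "w \<in> borel_measurable PE" "v \<in> borel_measurable PE"
  shows "(\<integral>\<^sup>+f. w f * orbit_sum v f \<partial>\<nu>) = (\<integral>\<^sup>+f. orbit_sum w f * v f \<partial>\<nu>)"
proof -
  have "(\<integral>\<^sup>+f. w f * orbit_sum v f \<partial>\<nu>)
      = (\<integral>\<^sup>+f. (\<integral>\<^sup>+t. w f * v (shift t f) \<partial>count_space UNIV) \<partial>\<nu>)"
    by (simp add: orbit_sum_def nn_integral_cmult)
  also have "\<dots> = (\<integral>\<^sup>+t. (\<integral>\<^sup>+f. w f * v (shift t f) \<partial>\<nu>) \<partial>count_space UNIV)"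
    by (rule nn_integral_count_space_nn_integral) auto
  also have "\<dots> = (\<integral>\<^sup>+t. (\<integral>\<^sup>+f. w (shift (- t) f) * v f \<partial>\<nu>) \<partial>count_space UNIV)"
  proof (rule nn_integral_cong)
    fix t
    show "(\<integral>\<^sup>+f. w f * v (shift t f) \<partial>\<nu>) = (\<integral>\<^sup>+f. w (shift (- t) f) * v f \<partial>\<nu>)"
      using nn_integral_shift[of "\<lambda>f. w f * v (shift t f)" "- t"] by simp
  qed
  also have "\<dots> = (\<integral>\<^sup>+t. (\<integral>\<^sup>+f. w (shift t f) * v f \<partial>\<nu>) \<partial>count_space UNIV)"
    by (rule nn_integral_count_space_uminus)
  also have "\<dots> = (\<integral>\<^sup>+f. (\<integral>\<^sup>+t. w (shift t f) * v f \<partial>count_space UNIV) \<partial>\<nu>)"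
    by (rule nn_integral_count_space_nn_integral[symmetric]) auto
  also have "\<dots> = (\<integral>\<^sup>+f. orbit_sum w f * v f \<partial>\<nu>)"
    by (simp add: orbit_sum_def nn_integral_multc)
  finally show ?thesis .
qed

lemma nn_integral_eq_if_same_orbit_sum:
  assumes [measurable]: "w \<in> borel_measurable PE" "v \<in> borel_measurable PE"
    and orbit_sum_w: "AE f in \<nu>. orbit_sum w f = indicator D f"
    and orbit_sum_v: "AE f in \<nu>. orbit_sum v f = indicator D f"
  shows "(\<integral>\<^sup>+f. w f \<partial>\<nu>) = (\<integral>\<^sup>+f. v f \<partial>\<nu>)"
proof -
  have absorb: "u f * indicator D f = u f" if "orbit_sum u f = indicator D f" for u f
    using le_orbit_sum[of u f] that by (auto simp: indicator_def split: if_splits)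
  have "(\<integral>\<^sup>+f. w f \<partial>\<nu>) = (\<integral>\<^sup>+f. w f * orbit_sum v f \<partial>\<nu>)"
  proof (rule nn_integral_cong_AE, use orbit_sum_w orbit_sum_v in eventually_elim)
    fix f assume "orbit_sum w f = indicator D f" "orbit_sum v f = indicator D f"
    then show "w f = w f * orbit_sum v f" using absorb[of w f] by simp
  qed
  also have "\<dots> = (\<integral>\<^sup>+f. orbit_sum w f * v f \<partial>\<nu>)"
    by (rule mass_transport) measurable
  also have "\<dots> = (\<integral>\<^sup>+f. v f \<partial>\<nu>)"
  proof (rule nn_integral_cong_AE, use orbit_sum_w orbit_sum_v in eventually_elim)
    fix f assume "orbit_sum w f = indicator D f" "orbit_sum v f = indicator D f"
    then show "orbit_sum w f * v f = v f" using absorb[of v f] by (simp add: mult.commute)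
  qed
  finally show ?thesis .
qed

definition tail_law :: "'d field measure" where
  "tail_law = density \<nu> (\<lambda>f. indicator {1<..} (f 0))"

lemma sets_tail_law [measurable_cong, simp]: "sets tail_law = sets PE"
  by (simp add: tail_law_def sets_eq_PE)

lemma nn_integral_tail_law:
  assumes [measurable]: "F \<in> borel_measurable PE"
  shows "(\<integral>\<^sup>+f. F f \<partial>tail_law) = (\<integral>\<^sup>+f. indicator {1<..} (f 0) * F f \<partial>\<nu>)"
  unfolding tail_law_def by (rule nn_integral_density) measurable

lemma AE_tail_law_iff: "(AE f in tail_law. Q f) \<longleftrightarrow> (AE f in \<nu>. 1 < f 0 \<longrightarrow> Q f)"
proof -
  have "(AE f in tail_law. Q f) \<longleftrightarrow> (AE f in \<nu>. 0 < (indicator {1<..} (f 0) :: ennreal) \<longrightarrow> Q f)"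
    unfolding tail_law_def by (rule AE_density) measurable
  also have "\<dots> \<longleftrightarrow> (AE f in \<nu>. 1 < f 0 \<longrightarrow> Q f)"
    by (intro AE_cong) (auto simp: indicator_def)
  finally show ?thesis .
qed

lemma AE_tail_law_gt_1: "AE f in tail_law. 1 < f 0"
  by (simp add: AE_tail_law_iff)

lemma AE_recentred_at_exceedances:
  assumes "AE f in tail_law. Q f"
  shows "AE f in \<nu>. \<forall>t. 1 < f t \<longrightarrow> Q (shift (- t) f)"
  using AE_shift[OF assms[unfolded AE_tail_law_iff]]
proof eventually_elim
  fix f assume "\<forall>h. 1 < shift h f 0 \<longrightarrow> Q (shift h f)"
  from this[rule_format, of "- t" for t] show "\<forall>t. 1 < f t \<longrightarrow> Q (shift (- t) f)" by simp
qed

sublocale tail: prob_space tail_law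
proof
  have "emeasure tail_law (space tail_law) = (\<integral>\<^sup>+f. 1 \<partial>tail_law)"
    by simp
  also have "\<dots> = (\<integral>\<^sup>+f. indicator {f. 1 < f 0} f \<partial>\<nu>)"
    by (subst nn_integral_tail_law) (auto intro!: nn_integral_cong simp: indicator_def)
  also have "\<dots> = emeasure \<nu> {f. 1 < f 0}"
    by (rule nn_integral_indicator) (simp add: sets_eq_PE Collect_in_sets_PE)
  finally show "emeasure tail_law (space tail_law) = 1"
    by (simp add: emeasure_exceedance_at_0)
qed

lemma AE_Ssum_finite_if_Bcnt_finite: "AE f in tail_law. Bcnt f < \<top> \<longrightarrow> Ssum f < \<top>"
proof -
  define w :: "'d field \<Rightarrow> ennreal" where
    "w f = indicator {1<..} (f 0) / Bcnt f * inverse (Mx f)" for f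
  have orbit_sum_w: "orbit_sum w f = indicator {f. 0 < Bcnt f \<and> Bcnt f < \<top>} f * inverse (Mx f)" for f
    unfolding w_def Bcnt_eq_orbit_sum by (subst orbit_sum_mult_invariant) (simp_all add: orbit_sum_normalized)
  have "(\<integral>\<^sup>+f. w f * Ssum f \<partial>\<nu>) = (\<integral>\<^sup>+f. orbit_sum w f * ennreal (f 0) \<partial>\<nu>)"
    unfolding Ssum_eq_orbit_sum by (rule mass_transport) (simp_all add: w_def[abs_def])
  also have "\<dots> \<le> (\<integral>\<^sup>+f. ennreal (f 0) / Mx f * indicator {f. 1 < Mx f} f \<partial>\<nu>)"
    by (intro nn_integral_mono)
       (auto simp: orbit_sum_w indicator_def Bcnt_pos_iff divide_ennreal_def mult.commute)
  also have "\<dots> < \<top>"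
    by (rule peak_share_finite)
  finally have "AE f in \<nu>. w f * Ssum f \<noteq> \<infinity>"
    by (intro nn_integral_PInf_AE) (auto simp: w_def[abs_def] less_top)
  then show ?thesis
    unfolding AE_tail_law_iff
  proof eventually_elim
    fix f assume finite_product: "w f * Ssum f \<noteq> \<infinity>"
    show "1 < f 0 \<longrightarrow> Bcnt f < \<top> \<longrightarrow> Ssum f < \<top>"
    proof (intro impI)
      assume "1 < f 0" "Bcnt f < \<top>"
      then have "w f \<noteq> 0"
        using Mx_finite_if_Bcnt_finite[of f] by (auto simp: w_def)
      with finite_product show "Ssum f < \<top>"
        by (auto simp: less_top[symmetric] ennreal_mult_top)
    qed
  qed
qed

lemma AE_Bcnt_finite_iff_Ssum_finite: "AE f in tail_law. Bcnt f < \<top> \<longleftrightarrow> Ssum f < \<top>"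
  using AE_Ssum_finite_if_Bcnt_finite
  by eventually_elim (auto intro: Bcnt_finite_if_Ssum_finite)

lemma AE_summable_clusters_iff_Bcnt: "AE f in \<nu>. f \<in> summable_clusters \<longleftrightarrow> 0 < Bcnt f \<and> Bcnt f < \<top>"
  using AE_recentred_at_exceedances[OF AE_Bcnt_finite_iff_Ssum_finite]
  by eventually_elim (auto simp: summable_clusters_def Bcnt_pos_iff Mx_gt_1_iff)

definition extremal_index_on :: "(int ^ 'd) set \<Rightarrow> real" where
  "extremal_index_on D = (\<integral>f. ratio_enn 1 (exceedance_count D f) \<partial>tail_law)"

definition extremal_index :: real where
  "extremal_index = extremal_index_on UNIV"

lemma extremal_index_on_nonneg: "0 \<le> extremal_index_on D"
  unfolding extremal_index_on_def by (intro integral_nonneg_AE) (simp add: ratio_enn_nonneg)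

lemma extremal_index_nonneg: "0 \<le> extremal_index"
  by (simp add: extremal_index_def extremal_index_on_nonneg)

lemma extremal_index_eq: "extremal_index = (\<integral>f. ratio_enn 1 (Bcnt f) \<partial>tail_law)"
  by (simp add: extremal_index_def extremal_index_on_def Bcnt_eq_exceedance_count)

lemma AE_exceedance_count_ge_1: "0 \<in> D \<Longrightarrow> AE f in tail_law. 1 \<le> exceedance_count D f"
  using AE_tail_law_gt_1 by eventually_elim (rule exceedance_count_ge_1)

lemma integrable_ratio_exceedance_count:
  assumes "0 \<in> D"
  shows "integrable tail_law (\<lambda>f. ratio_enn 1 (exceedance_count D f))"
proof (rule tail.integrable_const_bound[where B = 1])
  show "AE f in tail_law. norm (ratio_enn 1 (exceedance_count D f)) \<le> 1"
    using AE_exceedance_count_ge_1[OF assms]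
    by eventually_elim (simp add: ratio_enn_nonneg ratio_enn_le_1)
qed measurable

lemma extremal_index_on_le_1:
  assumes "0 \<in> D"
  shows "extremal_index_on D \<le> 1"
proof -
  have "extremal_index_on D \<le> (\<integral>f. 1 \<partial>tail_law)"
    unfolding extremal_index_on_def
  proof (rule integral_mono_AE[OF integrable_ratio_exceedance_count[OF assms]])
    show "AE f in tail_law. ratio_enn 1 (exceedance_count D f) \<le> 1"
      using AE_exceedance_count_ge_1[OF assms] by eventually_elim (rule ratio_enn_le_1)
  qed simp
  then show ?thesis using tail.prob_space by simp
qed

lemma extremal_index_on_antimono:
  assumes "C \<subseteq> D" "0 \<in> C"
  shows "extremal_index_on D \<le> extremal_index_on C"
  unfolding extremal_index_on_def
proof (rule integral_mono_AE)
  show "AE f in tail_law. ratio_enn 1 (exceedance_count D f) \<le> ratio_enn 1 (exceedance_count C f)"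
    using AE_exceedance_count_ge_1[OF assms(2)]
  proof eventually_elim
    fix f :: "'d field" assume "1 \<le> exceedance_count C f"
    then show "ratio_enn 1 (exceedance_count D f) \<le> ratio_enn 1 (exceedance_count C f)"
      by (rule ratio_enn_1_antimono[OF exceedance_count_mono[OF assms(1)]])
  qed
qed (use assms in \<open>auto intro!: integrable_ratio_exceedance_count\<close>)

lemma ennreal_extremal_index_on:
  assumes "0 \<in> D"
  shows "ennreal (extremal_index_on D) = (\<integral>\<^sup>+f. indicator {1<..} (f 0) / exceedance_count D f \<partial>\<nu>)"
proof -
  have "ennreal (extremal_index_on D) = (\<integral>\<^sup>+f. ennreal (ratio_enn 1 (exceedance_count D f)) \<partial>tail_law)"
    unfolding extremal_index_on_def
    by (rule nn_integral_eq_integral[symmetric])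
       (auto simp: integrable_ratio_exceedance_count assms ratio_enn_nonneg)
  also have "\<dots> = (\<integral>\<^sup>+f. indicator {1<..} (f 0) * ennreal (ratio_enn 1 (exceedance_count D f)) \<partial>\<nu>)"
    by (rule nn_integral_tail_law) measurable
  also have "\<dots> = (\<integral>\<^sup>+f. indicator {1<..} (f 0) / exceedance_count D f \<partial>\<nu>)"
  proof (rule nn_integral_cong)
    fix f :: "'d field"
    have "0 < exceedance_count D f" if "1 < f 0"
      using exceedance_count_ge_1[OF assms, of f] that by (auto intro: less_le_trans[OF zero_less_one])
    then show "indicator {1<..} (f 0) * ennreal (ratio_enn 1 (exceedance_count D f))
        = indicator {1<..} (f 0) / exceedance_count D f"
      by (simp add: indicator_def ennreal_ratio_enn)
  qed
  finally show ?thesis .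
qed

lemma nn_integral_eq_extremal_index:
  assumes [measurable]: "w \<in> borel_measurable PE"
    and orbit_sum_w: "AE f in \<nu>. orbit_sum w f = indicator summable_clusters f"
  shows "(\<integral>\<^sup>+f. w f \<partial>\<nu>) = ennreal extremal_index"
proof -
  have "(\<integral>\<^sup>+f. w f \<partial>\<nu>) = (\<integral>\<^sup>+f. indicator {1<..} (f 0) / Bcnt f \<partial>\<nu>)"
  proof (rule nn_integral_eq_if_same_orbit_sum[OF _ _ orbit_sum_w])
    show "AE f in \<nu>. orbit_sum (\<lambda>f. indicator {1<..} (f 0) / Bcnt f) f = indicator summable_clusters f"
      using AE_summable_clusters_iff_Bcnt
      by eventually_elim (simp add: Bcnt_eq_orbit_sum orbit_sum_normalized indicator_def)
  qed measurable
  then show ?thesis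
    by (simp add: extremal_index_def ennreal_extremal_index_on Bcnt_eq_exceedance_count)
qed

lemma nn_integral_mass_share:
  "(\<integral>\<^sup>+f. ennreal (f 0) / Ssum f * indicator {f. 1 < Mx f} f \<partial>\<nu>) = ennreal extremal_index"
proof (rule nn_integral_eq_extremal_index)
  have "{f. 1 < Mx f} \<in> sets (PE :: 'd field measure)"
    by (rule Collect_in_sets_PE) measurable
  then show "(\<lambda>f. ennreal (f 0) / Ssum f * indicator {f. 1 < Mx f} f) \<in> borel_measurable PE"
    by measurable
  show "AE f in \<nu>. orbit_sum (\<lambda>f. ennreal (f 0) / Ssum f * indicator {f. 1 < Mx f} f) f
      = indicator summable_clusters f"
  proof (rule AE_I2)
    fix f :: "'d field"
    have "0 < Ssum f" if "1 < Mx f"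
      using that Mx_le_Ssum[of f] by (auto simp: zero_less_iff_neq_zero)
    moreover have "orbit_sum (\<lambda>f. ennreal (f 0) / Ssum f * indicator {f. 1 < Mx f} f) f
        = indicator {f. 0 < Ssum f \<and> Ssum f < \<top>} f * indicator {f. 1 < Mx f} f"
      unfolding Ssum_eq_orbit_sum
      by (subst orbit_sum_mult_invariant) (simp_all add: orbit_sum_normalized indicator_def)
    ultimately show "orbit_sum (\<lambda>f. ennreal (f 0) / Ssum f * indicator {f. 1 < Mx f} f) f
        = indicator summable_clusters f"
      by (auto simp: summable_clusters_def indicator_def)
  qed
qed

lemma extremal_index_on_UN_tendsto:
  assumes "incseq D" "\<And>k. 0 \<in> D k"
  shows "(\<lambda>k. extremal_index_on (D k)) \<longlonglongrightarrow> extremal_index_on (\<Union>k. D k)"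
  unfolding extremal_index_on_def
proof (rule integral_dominated_convergence[where w = "\<lambda>_. 1"])
  have "(\<lambda>k. exceedance_count (D k) f) \<longlonglongrightarrow> exceedance_count (\<Union>k. D k) f" for f
    using Lim_emeasure_incseq[of "\<lambda>k. exceedances f \<inter> D k" "count_space UNIV"] assms(1)
    by (simp add: exceedance_count_def incseq_def le_infI2)
  moreover have "AE f in tail_law. 1 \<le> exceedance_count (\<Union>k. D k) f"
    using assms(2) by (intro AE_exceedance_count_ge_1) auto
  ultimately show "AE f in tail_law. (\<lambda>k. ratio_enn 1 (exceedance_count (D k) f))
      \<longlonglongrightarrow> ratio_enn 1 (exceedance_count (\<Union>k. D k) f)"
    by (auto elim!: eventually_mono intro!: tendsto_ratio_enn_1)
  show "AE f in tail_law. norm (ratio_enn 1 (exceedance_count (D k) f)) \<le> 1" for k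
    using AE_exceedance_count_ge_1[OF assms(2)[of k]]
    by eventually_elim (simp add: ratio_enn_nonneg ratio_enn_le_1)
qed simp_all

lemma nn_integral_exceedance_share:
  assumes "s \<in> D"
  shows "(\<integral>\<^sup>+f. indicator {1<..} (f s) / exceedance_count D f \<partial>\<nu>)
      = ennreal (extremal_index_on ((\<lambda>t. t - s) ` D))"
proof -
  have "(\<integral>\<^sup>+f. indicator {1<..} (f s) / exceedance_count D f \<partial>\<nu>)
      = (\<integral>\<^sup>+f. indicator {1<..} (shift s f s) / exceedance_count D (shift s f) \<partial>\<nu>)"
    by (rule nn_integral_shift[symmetric]) measurable
  also have "\<dots> = (\<integral>\<^sup>+f. indicator {1<..} (f 0) / exceedance_count ((\<lambda>t. t - s) ` D) f \<partial>\<nu>)"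
    by (simp add: exceedance_count_shift) (simp add: shift_def)
  also have "\<dots> = ennreal (extremal_index_on ((\<lambda>t. t - s) ` D))"
    using assms by (intro ennreal_extremal_index_on[symmetric]) auto
  finally show ?thesis .
qed

lemma measure_exceedance_eq_sum:
  assumes "finite D"
  shows "measure \<nu> {f. \<exists>t\<in>D. 1 < f t} = (\<Sum>s\<in>D. extremal_index_on ((\<lambda>t. t - s) ` D))"
proof -
  have "emeasure \<nu> {f. \<exists>t\<in>D. 1 < f t} = (\<integral>\<^sup>+f. indicator {f. \<exists>t\<in>D. 1 < f t} f \<partial>\<nu>)"
    using assms by (intro nn_integral_indicator[symmetric]) (simp add: sets_eq_PE Collect_in_sets_PE)
  also have "\<dots> = (\<integral>\<^sup>+f. (\<Sum>s\<in>D. indicator {1<..} (f s) / exceedance_count D f) \<partial>\<nu>)"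
  proof (rule nn_integral_cong)
    fix f :: "'d field"
    have "exceedance_count D f < \<top>"
      using assms by (simp add: exceedance_count_def less_top[symmetric])
    then have "indicator {f. \<exists>t\<in>D. 1 < f t} f = exceedance_count D f / exceedance_count D f"
      using exceedance_count_eq_0_iff[of D f] by (auto simp: indicator_def not_le)
    also have "\<dots> = (\<Sum>s\<in>D. indicator {1<..} (f s) / exceedance_count D f)"
      using assms by (simp add: divide_ennreal_def sum_distrib_right exceedance_count_finite)
    finally show "indicator {f. \<exists>t\<in>D. 1 < f t} f
        = (\<Sum>s\<in>D. indicator {1<..} (f s) / exceedance_count D f)" .
  qed
  also have "\<dots> = (\<Sum>s\<in>D. \<integral>\<^sup>+f. indicator {1<..} (f s) / exceedance_count D f \<partial>\<nu>)"
    by (rule nn_integral_sum) measurable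
  also have "\<dots> = ennreal (\<Sum>s\<in>D. extremal_index_on ((\<lambda>t. t - s) ` D))"
    by (simp add: nn_integral_exceedance_share extremal_index_on_nonneg)
  finally show ?thesis
    by (simp add: measure_def sum_nonneg extremal_index_on_nonneg)
qed

lemma measure_exceedance_ge:
  assumes "finite D"
  shows "real (card D) * extremal_index \<le> measure \<nu> {f. \<exists>t\<in>D. 1 < f t}"
proof -
  have "(\<Sum>s\<in>D. extremal_index) \<le> (\<Sum>s\<in>D. extremal_index_on ((\<lambda>t. t - s) ` D))"
    unfolding extremal_index_def by (intro sum_mono extremal_index_on_antimono) auto
  then show ?thesis by (simp add: measure_exceedance_eq_sum assms)
qed

lemma measure_exceedance_le:
  assumes "finite D" "C \<subseteq> D" "0 \<in> B" and sum_in_D: "\<And>s t. s \<in> C \<Longrightarrow> t \<in> B \<Longrightarrow> s + t \<in> D"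
  shows "measure \<nu> {f. \<exists>t\<in>D. 1 < f t}
    \<le> real (card D) - real (card C) + real (card C) * extremal_index_on B"
proof -
  have "B \<subseteq> (\<lambda>t. t - s) ` D" if "s \<in> C" for s
    using sum_in_D[OF that] by (force intro!: image_eqI[of _ _ "s + t" for t])
  then have "(\<Sum>s\<in>C. extremal_index_on ((\<lambda>t. t - s) ` D)) \<le> real (card C) * extremal_index_on B"
    using sum_mono[of C "\<lambda>s. extremal_index_on ((\<lambda>t. t - s) ` D)" "\<lambda>_. extremal_index_on B"] assms(3)
    by (simp add: extremal_index_on_antimono)
  moreover have "(\<Sum>s\<in>D - C. extremal_index_on ((\<lambda>t. t - s) ` D)) \<le> (\<Sum>s\<in>D - C. 1)"
    by (intro sum_mono extremal_index_on_le_1) auto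
  moreover have "(\<Sum>s\<in>D - C. 1) = real (card D) - real (card C)"
    using assms(1,2) by (simp add: card_Diff_subset card_mono finite_subset of_nat_diff)
  ultimately show ?thesis
    using assms(1,2) by (simp add: measure_exceedance_eq_sum sum.subset_diff)
qed

lemma measure_cube_exceedance_le:
  "measure \<nu> {f. \<exists>t\<in>cube n. 1 < f t}
    \<le> real (card (int_box 0 (int n) :: (int ^ 'd) set))
      - real (card (int_box (int k) (int n - int k) :: (int ^ 'd) set))
      + real (card (int_box (int k) (int n - int k) :: (int ^ 'd) set))
        * extremal_index_on (int_box (- int k) (int k))"
  unfolding cube_eq_int_box
proof (rule measure_exceedance_le[OF finite_int_box])
  fix s t :: "int ^ 'd"
  assume "s \<in> int_box (int k) (int n - int k)" "t \<in> int_box (- int k) (int k)"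
  from int_box_add[OF this] show "s + t \<in> int_box 0 (int n)" by simp
qed (simp add: int_box_mono, simp add: int_box_def)

definition cube_exceedance_rate :: "nat \<Rightarrow> real" where
  "cube_exceedance_rate n = measure \<nu> {f. \<exists>t\<in>cube n. 1 < f t} / real n ^ CARD('d)"

lemma eventually_cube_exceedance_rate_gt:
  assumes "a < extremal_index"
  shows "\<forall>\<^sub>F n in sequentially. a < cube_exceedance_rate n"
proof -
  let ?density = "\<lambda>n. real (card (int_box 0 (int n - 0) :: (int ^ 'd) set)) / real n ^ CARD('d)"
  have "(\<lambda>n. ?density n * extremal_index) \<longlonglongrightarrow> 1 * extremal_index"
    by (intro tendsto_mult int_box_density_tendsto tendsto_const)
  then have "\<forall>\<^sub>F n in sequentially. a < ?density n * extremal_index"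
    using assms by (intro order_tendstoD) auto
  then show ?thesis
  proof eventually_elim
    fix n assume "a < ?density n * extremal_index"
    also have "\<dots> \<le> cube_exceedance_rate n"
      using measure_exceedance_ge[OF finite_int_box, of 0 "int n"]
      by (simp add: cube_exceedance_rate_def cube_eq_int_box divide_right_mono)
    finally show "a < cube_exceedance_rate n" .
  qed
qed

lemma eventually_cube_exceedance_rate_less:
  assumes "extremal_index < a"
  shows "\<forall>\<^sub>F n in sequentially. cube_exceedance_rate n < a"
proof -
  have "(\<lambda>k. extremal_index_on (int_box (- int k) (int k))) \<longlonglongrightarrow> extremal_index"
    using extremal_index_on_UN_tendsto[of "\<lambda>k. int_box (- int k) (int k)"]
    by (simp add: UN_int_box extremal_index_def incseq_def int_box_mono) (simp add: int_box_def)
  from order_tendstoD(2)[OF this assms]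
  obtain k where k: "extremal_index_on (int_box (- int k) (int k)) < a"
    by (auto simp: eventually_sequentially)
  let ?density = "\<lambda>k n. real (card (int_box k (int n - k) :: (int ^ 'd) set)) / real n ^ CARD('d)"
  let ?bound = "\<lambda>n. ?density 0 n - ?density (int k) n
      + ?density (int k) n * extremal_index_on (int_box (- int k) (int k))"
  have "?bound \<longlonglongrightarrow> 1 - 1 + 1 * extremal_index_on (int_box (- int k) (int k))"
    by (intro tendsto_add tendsto_diff tendsto_mult int_box_density_tendsto tendsto_const)
  then have "\<forall>\<^sub>F n in sequentially. ?bound n < a"
    using k by (intro order_tendstoD) auto
  then show ?thesis
  proof eventually_elim
    fix n assume "?bound n < a"
    moreover have "cube_exceedance_rate n \<le> ?bound n"
      using divide_right_mono[OF measure_cube_exceedance_le[of n k], of "real n ^ CARD('d)"]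
      by (simp add: cube_exceedance_rate_def add_divide_distrib diff_divide_distrib)
    ultimately show "cube_exceedance_rate n < a" by simp
  qed
qed

lemma cube_exceedance_rate_tendsto: "cube_exceedance_rate \<longlonglongrightarrow> extremal_index"
  by (rule order_tendstoI)
     (simp_all add: eventually_cube_exceedance_rate_gt eventually_cube_exceedance_rate_less)

end

section \<open>Anchoring maps\<close>

lemma measurable_option_count_spaceI:
  fixes I :: "'a \<Rightarrow> 'b::countable option"
  assumes [measurable]: "\<And>j. Measurable.pred N (\<lambda>x. I x = Some j)"
  shows "I \<in> measurable N (count_space UNIV)"
proof -
  have pred: "Measurable.pred N (\<lambda>x. I x = opt)" for opt
  proof (cases opt)
    case None
    then have eq: "(\<lambda>x. I x = opt) = (\<lambda>x. \<forall>j. I x \<noteq> Some j)"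
      by auto
    show ?thesis unfolding eq by measurable
  qed simp
  have "I -` {opt} \<inter> space N \<in> sets N" for opt
    using pred[of opt] by (simp add: pred_def vimage_def Int_def conj_commute)
  then show ?thesis
    by (simp add: measurable_count_space_eq2_countable)
qed

lemma measurable_anchoring_map: "anchoring_map I \<Longrightarrow> I \<in> measurable PE (count_space UNIV)"
  by (simp add: anchoring_map_def)

lemma anchoring_map_shift_iff:
  assumes anchoring: "anchoring_map I" and nonneg: "\<forall>t. 0 \<le> f t"
  shows "I (shift h f) = Some j \<longleftrightarrow> I f = Some (j - h)"
proof -
  have equivariant: "I (shift i g) = Some (k + i)" if "\<forall>t. 0 \<le> g t" "I g = Some k" for g i k
    using anchoring that by (simp add: anchoring_map_def)
  show ?thesis
    using equivariant[OF nonneg, of "j - h" h] equivariant[OF shift_nonneg[OF nonneg], of h j "- h"] by auto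
qed

lemma anchoring_map_ge_1:
  assumes anchoring: "anchoring_map I" and nonneg: "\<forall>t. 0 \<le> f t" and "I f = Some j" "1 \<le> f s"
  shows "1 \<le> f j"
proof -
  have "I (shift (- s) f) = Some (j - s)"
    using assms by (simp add: anchoring_map_shift_iff)
  then have "min (shift (- s) f 0) 1 \<le> shift (- s) f (j - s)"
    using anchoring shift_nonneg[OF nonneg] unfolding anchoring_map_def by blast
  then show ?thesis
    using \<open>1 \<le> f s\<close> by (simp add: shift_def)
qed

definition anchored_clusters :: "('d::finite field \<Rightarrow> (int ^ 'd) option) \<Rightarrow> 'd field set" where
  "anchored_clusters I = {f. 1 < f 0 \<and> I f = Some 0 \<and> Ssum f < \<top>}"

lemma orbit_sum_anchored_clusters:
  assumes anchoring: "anchoring_map I" and nonneg: "\<forall>t. 0 \<le> f t" and neq_1: "\<forall>t. f t \<noteq> 1"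
    and anchored: "f \<in> summable_clusters \<Longrightarrow> I f \<noteq> None"
  shows "orbit_sum (indicator (anchored_clusters I)) f = indicator summable_clusters f"
proof (cases "f \<in> summable_clusters")
  case False
  then have "indicator (anchored_clusters I) (shift t f) = (0 :: ennreal)" for t
    by (auto simp: indicator_def anchored_clusters_def summable_clusters_def Mx_gt_1_iff)
  with False show ?thesis by (simp add: orbit_sum_def)
next
  case True
  then obtain j where j: "I f = Some j" using anchored by auto
  obtain s where "1 < f s"
    using True by (auto simp: summable_clusters_def Mx_gt_1_iff)
  then have "1 < f j"
    using anchoring_map_ge_1[OF anchoring nonneg j, of s] neq_1[rule_format, of j] by simp
  have "indicator (anchored_clusters I) (shift t f) = (indicator {- j} t :: ennreal)" for t
    using True \<open>1 < f j\<close>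
    by (auto simp: indicator_def anchored_clusters_def summable_clusters_def
        anchoring_map_shift_iff[OF anchoring nonneg] j minus_equation_iff[of t])
  with True show ?thesis by (simp add: orbit_sum_def)
qed

context tail_measure
begin

lemma AE_orbit_sum_anchored_clusters:
  assumes anchoring: "anchoring_map I"
    and anchored: "AE f in tail_law. Ssum f < \<top> \<longrightarrow> I f \<noteq> None"
  shows "AE f in \<nu>. orbit_sum (indicator (anchored_clusters I)) f = indicator summable_clusters f"
  using AE_nonneg AE_shift[OF AE_neq_1_at_0] AE_recentred_at_exceedances[OF anchored]
proof eventually_elim
  fix f :: "'d field"
  assume nonneg: "\<forall>t. 0 \<le> f t" and neq_1: "\<forall>h. shift h f 0 \<noteq> 1"
    and anchored: "\<forall>t. 1 < f t \<longrightarrow> Ssum (shift (- t) f) < \<top> \<longrightarrow> I (shift (- t) f) \<noteq> None"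
  show "orbit_sum (indicator (anchored_clusters I)) f = indicator summable_clusters f"
  proof (rule orbit_sum_anchored_clusters[OF anchoring nonneg])
    show "\<forall>t. f t \<noteq> 1"
      using neq_1[rule_format, of "- t" for t] by simp
    show "I f \<noteq> None" if "f \<in> summable_clusters"
      using that anchored
      by (auto simp: summable_clusters_def Mx_gt_1_iff anchoring_map_shift_iff[OF anchoring nonneg])
  qed
qed

lemma measure_anchor_at_0:
  assumes anchoring: "anchoring_map I"
    and "AE f in tail_law. Ssum f < \<top> \<longrightarrow> I f \<noteq> None"
  shows "measure tail_law {f. I f = Some 0 \<and> Ssum f < \<top>} = extremal_index"
proof -
  note [measurable] = measurable_anchoring_map[OF anchoring]
  have [measurable]: "{f. I f = Some 0 \<and> Ssum f < \<top>} \<in> sets PE" "anchored_clusters I \<in> sets PE"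
    unfolding anchored_clusters_def by (auto intro!: Collect_in_sets_PE)
  have "emeasure tail_law {f. I f = Some 0 \<and> Ssum f < \<top>}
      = (\<integral>\<^sup>+f. indicator {f. I f = Some 0 \<and> Ssum f < \<top>} f \<partial>tail_law)"
    by simp
  also have "\<dots> = (\<integral>\<^sup>+f. indicator {1<..} (f 0) * indicator {f. I f = Some 0 \<and> Ssum f < \<top>} f \<partial>\<nu>)"
    by (rule nn_integral_tail_law) measurable
  also have "\<dots> = (\<integral>\<^sup>+f. indicator (anchored_clusters I) f \<partial>\<nu>)"
    by (intro nn_integral_cong) (simp add: indicator_def anchored_clusters_def)
  also have "\<dots> = ennreal extremal_index"
    by (rule nn_integral_eq_extremal_index[OF _ AE_orbit_sum_anchored_clusters[OF assms]]) measurable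
  finally show ?thesis
    by (simp add: measure_def extremal_index_nonneg)
qed

end

lemma linear_order_imp_class_linorder:
  assumes "linear_order r"
  shows "class.linorder (\<lambda>i j. (i, j) \<in> r) (\<lambda>i j. (i, j) \<in> r \<and> i \<noteq> j)"
proof -
  have "refl r" "trans r" "antisym r" "total r"
    using assms by (auto simp: linear_order_on_def partial_order_on_def preorder_on_def)
  moreover from this have "(i, j) \<in> r \<or> (j, i) \<in> r" for i j
    by (cases "i = j") (auto simp: total_on_def dest: reflD)
  ultimately show ?thesis
    by unfold_locales (auto dest: reflD antisymD transD)
qed

lemma ord_min_eq_iff:
  assumes "linear_order r" "finite A" "A \<noteq> {}"
  shows "ord_min r A = j \<longleftrightarrow> j \<in> A \<and> (\<forall>i\<in>A. (j, i) \<in> r)"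
proof -
  interpret r: linorder "\<lambda>i j. (i, j) \<in> r" "\<lambda>i j. (i, j) \<in> r \<and> i \<noteq> j"
    by (rule linear_order_imp_class_linorder) fact
  have Min: "r.Min A \<in> A" "\<forall>i\<in>A. (r.Min A, i) \<in> r"
    using assms by simp_all
  then have "ord_min r A = r.Min A"
    unfolding ord_min_def by (intro the_equality) (auto intro: r.order.antisym)
  with Min show ?thesis by (auto intro: r.order.antisym)
qed

lemma Ife_eq_Some_iff:
  assumes "linear_order r"
  shows "Ife r f = Some j \<longleftrightarrow> Ssum f < \<top> \<and> 1 < f j \<and> (\<forall>i. 1 < f i \<longrightarrow> (j, i) \<in> r)"
proof (cases "Ssum f < \<top> \<and> (\<exists>t. 1 < f t)")
  case True
  have "finite {t. 1 < f t}"
    using True by (auto intro: finite_subset[OF _ finite_level_set_if_Ssum_finite[of f 1]])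
  with True show ?thesis
    using ord_min_eq_iff[OF assms, of "{t. 1 < f t}" j] by (auto simp: Ife_def)
qed (auto simp: Ife_def)

lemma maximizers_finite_nonempty_if_Ssum_finite:
  assumes "Ssum f < \<top>" "0 < f s"
  shows "finite {j. \<forall>i. f i \<le> f j}" "{j. \<forall>i. f i \<le> f j} \<noteq> {}"
proof -
  let ?level = "{t. f s \<le> f t}"
  have finite_level: "finite ?level"
    by (rule finite_level_set_if_Ssum_finite) fact+
  then show "finite {j. \<forall>i. f i \<le> f j}"
    by (rule finite_subset[rotated]) auto
  have "Max (f ` ?level) \<in> f ` ?level"
    using finite_level by (intro Max_in) auto
  then obtain m where m: "m \<in> ?level" "f m = Max (f ` ?level)" by auto
  have "f i \<le> f m" for i
  proof (cases "i \<in> ?level")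
    case True
    then show ?thesis using finite_level m(2) by simp
  next
    case False
    then show ?thesis using m(1) by simp
  qed
  then show "{j. \<forall>i. f i \<le> f j} \<noteq> {}" by auto
qed

lemma IA_eq_Some_iff:
  assumes "linear_order r"
  shows "IA r f = Some j \<longleftrightarrow>
    Ssum f < \<top> \<and> 0 < f j \<and> (\<forall>i. f i \<le> f j) \<and> (\<forall>k. (\<forall>i. f i \<le> f k) \<longrightarrow> (j, k) \<in> r)"
proof (cases "Ssum f < \<top> \<and> (\<exists>t. 0 < f t)")
  case True
  then obtain s where s: "Ssum f < \<top>" "0 < f s" by auto
  then have "0 < f j" if "\<forall>i. f i \<le> f j"
    using that by (meson less_le_trans)
  then show ?thesis
    using True ord_min_eq_iff[OF assms maximizers_finite_nonempty_if_Ssum_finite[OF s], of j]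
    by (auto simp: IA_def)
qed (auto simp: IA_def)

lemma anchoring_map_first_exceedance:
  assumes "transl_inv_total_order r"
  shows "anchoring_map (Ife r)"
proof -
  have linear: "linear_order r" and translate: "\<And>i j h. (i, j) \<in> r \<Longrightarrow> (i + h, j + h) \<in> r"
    using assms by (auto simp: transl_inv_total_order_def)
  note iff = Ife_eq_Some_iff[OF linear]
  have "Ife r \<in> measurable PE (count_space UNIV)"
    by (rule measurable_option_count_spaceI) (unfold iff, measurable)
  moreover have "Ife r (shift i f) = Some (j + i)" if "Ife r f = Some j" for f and i j
    unfolding iff
  proof (intro conjI allI impI)
    show "Ssum (shift i f) < \<top>"
      using that by (simp add: iff)
    show "1 < shift i f (j + i)"
      using that by (simp add: iff shift_def)
    fix k assume "1 < shift i f k"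
    then have "(j, k - i) \<in> r" using that by (simp add: iff shift_def)
    from translate[OF this, of i] show "(j + i, k) \<in> r" by simp
  qed
  moreover have "min (f 0) 1 \<le> f j" if "Ife r f = Some j" for f and j
    using that by (auto simp: iff intro: min.coboundedI2)
  ultimately show ?thesis
    by (simp add: anchoring_map_def)
qed

lemma anchoring_map_first_maximum:
  assumes "transl_inv_total_order r"
  shows "anchoring_map (IA r)"
proof -
  have linear: "linear_order r" and translate: "\<And>i j h. (i, j) \<in> r \<Longrightarrow> (i + h, j + h) \<in> r"
    using assms by (auto simp: transl_inv_total_order_def)
  note iff = IA_eq_Some_iff[OF linear]
  have [measurable]: "Measurable.pred PE (\<lambda>f :: 'a field. f i \<le> f j)" for i j
    unfolding pred_def by (intro borel_measurable_le measurable_PE_coord)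
  have "IA r \<in> measurable PE (count_space UNIV)"
    by (rule measurable_option_count_spaceI) (unfold iff, measurable)
  moreover have "IA r (shift i f) = Some (j + i)" if "IA r f = Some j" for f and i j
    unfolding iff
  proof (intro conjI allI impI)
    show "Ssum (shift i f) < \<top>"
      using that by (simp add: iff)
    show "0 < shift i f (j + i)" "shift i f k \<le> shift i f (j + i)" for k
      using that by (simp_all add: iff shift_def)
    fix k assume "\<forall>l. shift i f l \<le> shift i f k"
    then have "f l \<le> f (k - i)" for l
      by (auto simp: shift_def dest!: spec[of _ "l + i"])
    then have "(j, k - i) \<in> r" using that by (simp add: iff)
    from translate[OF this, of i] show "(j + i, k) \<in> r" by simp
  qed
  moreover have "min (f 0) 1 \<le> f j" if "IA r f = Some j" for f and j
    using that by (auto simp: iff intro: min.coboundedI1)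
  ultimately show ?thesis
    by (simp add: anchoring_map_def)
qed

lemma zero_homogeneous_first_maximum:
  assumes "linear_order r"
  shows "zero_homogeneous (IA r)"
proof -
  have "IA r (\<lambda>t. c * f t) = Some j \<longleftrightarrow> IA r f = Some j" if "0 < c" for c f j
    using that by (simp add: IA_eq_Some_iff[OF assms] Ssum_scale_finite_iff zero_less_mult_iff)
  then show ?thesis
    unfolding zero_homogeneous_def by (metis not_None_eq)
qed

section \<open>Uniqueness of measures on fields\<close>

lemma measure_eqI_countable_cover:
  fixes C :: "'i::countable \<Rightarrow> 'a set"
  assumes sets_eq: "sets \<mu> = sets \<mu>'"
    and [measurable]: "\<And>i. C i \<in> sets \<mu>"
    and eq: "\<And>i A. A \<in> sets \<mu> \<Longrightarrow> emeasure \<mu> (C i \<inter> A) = emeasure \<mu>' (C i \<inter> A)"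
    and cover: "AE x in \<mu>. x \<in> (\<Union>i. C i)" "AE x in \<mu>'. x \<in> (\<Union>i. C i)"
  shows "\<mu> = \<mu>'"
proof (rule measure_eqI[OF sets_eq])
  define D where "D = disjointed (\<lambda>n. C (from_nat n))"
  have UN_D: "(\<Union>n. D n) = (\<Union>i. C i)"
    unfolding D_def UN_disjointed_eq by (metis UN_extend_simps(10) surj_from_nat)
  have D_subset: "D n \<subseteq> C (from_nat n)" for n
    unfolding D_def by (rule disjointed_subset)
  have D_sets: "range D \<subseteq> sets \<mu>"
    unfolding D_def by (rule sets.range_disjointed_sets) auto
  fix A assume A: "A \<in> sets \<mu>"
  have emeasure_eq_suminf: "emeasure \<kappa> A = (\<Sum>n. emeasure \<kappa> (D n \<inter> A))"
    if "sets \<kappa> = sets \<mu>" "AE x in \<kappa>. x \<in> (\<Union>i. C i)" for \<kappa>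
  proof -
    have "emeasure \<kappa> A = emeasure \<kappa> (\<Union>n. D n \<inter> A)"
      using that(2) A D_sets by (intro emeasure_eq_AE) (auto simp: that(1) UN_D elim!: eventually_mono)
    also have "\<dots> = (\<Sum>n. emeasure \<kappa> (D n \<inter> A))"
      using A D_sets disjoint_family_disjointed[of "\<lambda>n. C (from_nat n)"]
      by (intro suminf_emeasure[symmetric])
         (auto simp: that(1) D_def disjoint_family_on_def)
    finally show ?thesis .
  qed
  have "emeasure \<mu> (D n \<inter> A) = emeasure \<mu>' (D n \<inter> A)" for n
    using eq[of "D n \<inter> A" "from_nat n"] A D_sets D_subset[of n]
    by (auto simp: Int_absorb1 Int_assoc[symmetric])
  then show "emeasure \<mu> A = emeasure \<mu>' A"
    using emeasure_eq_suminf[OF refl cover(1)] emeasure_eq_suminf[OF sets_eq[symmetric] cover(2)] by simp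
qed

definition strictly_below :: "(int ^ 'd::finite) set \<Rightarrow> 'd field \<Rightarrow> 'd field set" where
  "strictly_below T x = {f. \<forall>t\<in>T. f t < x t}"

lemma strictly_below_in_sets [measurable]:
  "finite T \<Longrightarrow> strictly_below T x \<in> sets (PE :: 'd::finite field measure)"
  unfolding strictly_below_def by (rule Collect_in_sets_PE) measurable

lemma Compl_strictly_below_in_sets [measurable]:
  "finite T \<Longrightarrow> - strictly_below T x \<in> sets (PE :: 'd::finite field measure)"
  using sets.compl_sets[OF strictly_below_in_sets] by (simp add: Compl_eq_Diff_UNIV)

lemma sets_PE_eq_sigma_strictly_below:
  "sets (PE :: 'd::finite field measure) = sigma_sets UNIV {strictly_below T x | T x. finite T}"
    (is "_ = sigma_sets UNIV ?G")
proof
  show "sigma_sets UNIV ?G \<subseteq> sets PE"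
    using sets.sigma_sets_subset[of ?G PE] strictly_below_in_sets by auto
  have coord: "(\<lambda>f. f t) \<in> borel_measurable (sigma UNIV ?G)" for t :: "int ^ 'd"
  proof (subst borel_measurable_iff_less, intro allI)
    fix a :: real
    have "{f \<in> space (sigma UNIV ?G). f t < a} = strictly_below {t} (\<lambda>_. a)"
      by (simp add: strictly_below_def space_measure_of_conv)
    also have "\<dots> \<in> sigma_sets UNIV ?G"
      by (rule sigma_sets.Basic) blast
    finally show "{f \<in> space (sigma UNIV ?G). f t < a} \<in> sets (sigma UNIV ?G)"
      by (simp add: sets_measure_of_conv)
  qed
  have "(\<lambda>f. f) \<in> measurable (sigma UNIV ?G) (PE :: 'd field measure)"
    by (rule measurable_PEI) (rule coord)
  then show "sets PE \<subseteq> sigma_sets UNIV ?G"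
    by (auto simp: measurable_def space_measure_of_conv sets_measure_of_conv)
qed

lemma Int_stable_strictly_below: "Int_stable {strictly_below T x | T x. finite T}"
proof (rule Int_stableI)
  fix A B :: "'d::finite field set"
  assume "A \<in> {strictly_below T x | T x. finite T}" "B \<in> {strictly_below T x | T x. finite T}"
  then obtain S x T y where AB: "A = strictly_below S x" "B = strictly_below T y"
    and fin: "finite S" "finite T" by auto
  have "A \<inter> B
      = strictly_below (S \<union> T) (\<lambda>t. if t \<in> S \<inter> T then min (x t) (y t) else if t \<in> S then x t else y t)"
    by (auto simp: AB strictly_below_def)
  then show "A \<inter> B \<in> {strictly_below T x | T x. finite T}"
    using fin by blast
qed

lemma finite_field_measure_eqI:
  fixes \<mu> \<mu>' :: "'d::finite field measure"
  assumes sets: "sets \<mu> = sets PE" "sets \<mu>' = sets PE"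
    and finite: "emeasure \<mu> UNIV < \<top>"
    and eq: "\<And>T x. finite T \<Longrightarrow> emeasure \<mu> (strictly_below T x) = emeasure \<mu>' (strictly_below T x)"
  shows "\<mu> = \<mu>'"
proof (rule measure_eqI_generator_eq[OF Int_stable_strictly_below])
  show "sets \<mu> = sigma_sets UNIV {strictly_below T x | T x. finite T}"
    "sets \<mu>' = sigma_sets UNIV {strictly_below T x | T x. finite T}"
    by (simp_all add: sets sets_PE_eq_sigma_strictly_below)
  have "UNIV = strictly_below {} (\<lambda>_. 0)"
    by (simp add: strictly_below_def)
  then show "range (\<lambda>_::nat. UNIV) \<subseteq> {strictly_below T x :: 'd field set | T x. finite T}"
    by blast
qed (use eq finite in auto)

lemma emeasure_coord_ge_Int_strictly_below:
  fixes \<mu> :: "'d::finite field measure"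
  assumes sets: "sets \<mu> = sets PE" and T: "finite T"
    and finite: "emeasure \<mu> (- strictly_below T x) < \<top>"
  shows "emeasure \<mu> ({f. \<epsilon> \<le> f s} \<inter> strictly_below T x)
    = emeasure \<mu> (- strictly_below (insert s T) (x(s := if s \<in> T then min \<epsilon> (x s) else \<epsilon>)))
      - emeasure \<mu> (- strictly_below T x)" (is "_ = emeasure \<mu> (- strictly_below _ ?y) - _")
proof -
  have "{f. \<epsilon> \<le> f s} \<inter> strictly_below T x
      = - strictly_below (insert s T) ?y - - strictly_below T x"
    by (auto simp: strictly_below_def not_less split: if_splits)
  moreover have "- strictly_below T x \<subseteq> - strictly_below (insert s T) ?y"
    by (auto simp: strictly_below_def split: if_splits)
  ultimately show ?thesis
    using T finite
    by (simp only:) (intro emeasure_Diff, auto simp: sets intro!: Compl_strictly_below_in_sets)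
qed

lemma emeasure_strictly_below_nonpos:
  fixes \<mu> :: "'d::finite field measure"
  assumes sets: "sets \<mu> = sets PE" and nonneg: "AE f in \<mu>. \<forall>t. 0 \<le> f t"
    and "finite T" "s \<in> T" "x s \<le> 0" "C \<in> sets PE"
  shows "emeasure \<mu> (C \<inter> strictly_below T x) = 0"
proof -
  have "AE f in \<mu>. f \<in> C \<inter> strictly_below T x \<longleftrightarrow> f \<in> {}"
    using nonneg
  proof eventually_elim
    fix f :: "'d field" assume "\<forall>t. 0 \<le> f t"
    then have "\<not> f s < x s"
      using \<open>x s \<le> 0\<close> by (simp add: not_less order_trans[of "x s" 0])
    then show "f \<in> C \<inter> strictly_below T x \<longleftrightarrow> f \<in> {}"
      using \<open>s \<in> T\<close> by (auto simp: strictly_below_def)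
  qed
  then have "emeasure \<mu> (C \<inter> strictly_below T x) = emeasure \<mu> {}"
    using assms by (intro emeasure_eq_AE) auto
  then show ?thesis by simp
qed

text \<open>Agreement at positive levels is enough: the inequalities defining \<^const>\<open>strictly_below\<close> are strict, so
  nonnegative fields never lie below a nonpositive level.\<close>

lemma emeasure_coord_ge_Int_eqI:
  fixes \<mu> \<mu>' :: "'d::finite field measure"
  assumes sets: "sets \<mu> = sets PE" "sets \<mu>' = sets PE"
    and nonneg: "AE f in \<mu>. \<forall>t. 0 \<le> f t" "AE f in \<mu>'. \<forall>t. 0 \<le> f t"
    and finite: "\<And>T x. finite T \<Longrightarrow> \<forall>t\<in>T. 0 < x t \<Longrightarrow> emeasure \<mu> (- strictly_below T x) < \<top>"
    and eq: "\<And>T x. finite T \<Longrightarrow> \<forall>t\<in>T. 0 < x t \<Longrightarrow>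
      emeasure \<mu> (- strictly_below T x) = emeasure \<mu>' (- strictly_below T x)"
    and "0 < \<epsilon>" "A \<in> sets PE"
  shows "emeasure \<mu> ({f. \<epsilon> \<le> f s} \<inter> A) = emeasure \<mu>' ({f. \<epsilon> \<le> f s} \<inter> A)"
proof -
  let ?C = "{f. \<epsilon> \<le> f s}"
  have C_sets: "?C \<in> sets PE"
    by (rule Collect_in_sets_PE) measurable
  have eq_below: "emeasure \<mu> (?C \<inter> strictly_below T x) = emeasure \<mu>' (?C \<inter> strictly_below T x)"
    if T: "finite T" for T x
  proof (cases "\<exists>t\<in>T. x t \<le> 0")
    case True
    then obtain t where t: "t \<in> T" "x t \<le> 0" by blast
    show ?thesis
      using emeasure_strictly_below_nonpos[OF sets(1) nonneg(1) T t(1) _ C_sets, of x]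
        emeasure_strictly_below_nonpos[OF sets(2) nonneg(2) T t(1) _ C_sets, of x] t(2) by simp
  next
    case False
    then have pos: "\<forall>t\<in>T. 0 < x t" by (simp add: not_le)
    define y where "y = x(s := if s \<in> T then min \<epsilon> (x s) else \<epsilon>)"
    have split: "emeasure \<kappa> (?C \<inter> strictly_below T x)
        = emeasure \<kappa> (- strictly_below (insert s T) y) - emeasure \<kappa> (- strictly_below T x)"
      if "sets \<kappa> = sets PE" "emeasure \<kappa> (- strictly_below T x) < \<top>" for \<kappa>
      unfolding y_def by (rule emeasure_coord_ge_Int_strictly_below[OF that(1) T that(2)])
    have "\<forall>t\<in>insert s T. 0 < y t"
      using pos \<open>0 < \<epsilon>\<close> by (simp add: y_def)
    then show ?thesis
      using split[OF sets(1)] split[OF sets(2)] finite[OF T pos] eq[OF T pos] eq[of "insert s T" y] T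
      by simp
  qed
  have "?C = - strictly_below {s} (\<lambda>_. \<epsilon>)"
    by (auto simp: strictly_below_def)
  then have "emeasure \<mu> ?C < \<top>"
    using finite[of "{s}" "\<lambda>_. \<epsilon>"] \<open>0 < \<epsilon>\<close> by simp
  then have "density \<mu> (indicator ?C) = density \<mu>' (indicator ?C)"
    using C_sets sets.top[of "PE :: 'd field measure"]
    by (intro finite_field_measure_eqI)
       (simp_all add: sets emeasure_restricted strictly_below_in_sets eq_below)
  then show ?thesis
    using emeasure_restricted[of ?C \<mu> A] emeasure_restricted[of ?C \<mu>' A] \<open>A \<in> sets PE\<close> C_sets
    by (simp add: sets)
qed

lemma field_measure_eqI:
  fixes \<mu> \<mu>' :: "'d::finite field measure"
  assumes sets: "sets \<mu> = sets PE" "sets \<mu>' = sets PE"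
    and nonneg: "AE f in \<mu>. \<forall>t. 0 \<le> f t" "AE f in \<mu>'. \<forall>t. 0 \<le> f t"
    and nonzero: "AE f in \<mu>. \<exists>t. 0 < f t" "AE f in \<mu>'. \<exists>t. 0 < f t"
    and finite: "\<And>T x. finite T \<Longrightarrow> \<forall>t\<in>T. 0 < x t \<Longrightarrow> emeasure \<mu> (- strictly_below T x) < \<top>"
    and eq: "\<And>T x. finite T \<Longrightarrow> \<forall>t\<in>T. 0 < x t \<Longrightarrow>
      emeasure \<mu> (- strictly_below T x) = emeasure \<mu>' (- strictly_below T x)"
  shows "\<mu> = \<mu>'"
proof (rule measure_eqI_countable_cover)
  define C :: "(int ^ 'd) \<times> nat \<Rightarrow> 'd field set" where "C = (\<lambda>(s, k). {f. 1 / real (Suc k) \<le> f s})"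
  show "C i \<in> sets \<mu>" for i
    unfolding C_def by (cases i) (simp add: sets Collect_in_sets_PE)
  show "emeasure \<mu> (C i \<inter> A) = emeasure \<mu>' (C i \<inter> A)" if "A \<in> sets \<mu>" for i A
  proof (cases i)
    case (Pair s k)
    show ?thesis
      unfolding C_def Pair prod.case
      by (rule emeasure_coord_ge_Int_eqI[OF sets nonneg finite eq]) (use that in \<open>auto simp: sets\<close>)
  qed
  have "f \<in> (\<Union>i. C i)" if pos: "0 < f t" for f t
  proof -
    obtain k where "1 / real (Suc k) < f t" using pos by (rule nat_approx_posE)
    then have "f \<in> C (t, k)" by (simp add: C_def)
    then show ?thesis by blast
  qed
  then show "AE f in \<mu>. f \<in> (\<Union>i. C i)" "AE f in \<mu>'. f \<in> (\<Union>i. C i)"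
    using nonzero by (auto elim!: eventually_mono)
qed (simp add: sets)

section \<open>The exponent measure of a spectral field\<close>

definition pareto_intensity :: "real measure" where
  "pareto_intensity = density lborel (\<lambda>z. ennreal (indicator {0<..} z / z\<^sup>2))"

lemma sets_pareto_intensity [measurable_cong, simp]: "sets pareto_intensity = sets borel"
  by (simp add: pareto_intensity_def)

lemma nn_integral_pareto_intensity:
  assumes [measurable]: "F \<in> borel_measurable borel"
  shows "(\<integral>\<^sup>+z. F z \<partial>pareto_intensity) = (\<integral>\<^sup>+z. ennreal (indicator {0<..} z / z\<^sup>2) * F z \<partial>lborel)"
  unfolding pareto_intensity_def by (rule nn_integral_density) measurable

lemma AE_pareto_intensity_iff:
  "(AE z in pareto_intensity. Q z) \<longleftrightarrow> (AE z in lborel. 0 < z \<longrightarrow> Q z)"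
proof -
  have "(AE z in pareto_intensity. Q z) \<longleftrightarrow> (AE z in lborel. 0 < ennreal (indicator {0<..} z / z\<^sup>2) \<longrightarrow> Q z)"
    unfolding pareto_intensity_def by (rule AE_density) measurable
  also have "\<dots> \<longleftrightarrow> (AE z in lborel. 0 < z \<longrightarrow> Q z)"
    by (intro AE_cong) (auto simp: indicator_def)
  finally show ?thesis .
qed

lemma AE_pareto_intensityI: "(\<And>z. 0 < z \<Longrightarrow> Q z) \<Longrightarrow> AE z in pareto_intensity. Q z"
  by (simp add: AE_pareto_intensity_iff)

lemma AE_pareto_intensity_neq: "AE z in pareto_intensity. z \<noteq> a"
  unfolding AE_pareto_intensity_iff using AE_lborel_singleton[of a] by eventually_elim simp

interpretation pareto_intensity: sigma_finite_measure pareto_intensity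
  unfolding pareto_intensity_def
  by (subst sigma_finite_measure.sigma_finite_iff_density_finite[OF sigma_finite_lborel]) auto

lemma emeasure_pareto_intensity_atLeast:
  assumes "0 < a"
  shows "emeasure pareto_intensity {a..} = ennreal (1 / a)"
proof -
  have "emeasure pareto_intensity {a..}
      = (\<integral>\<^sup>+z. ennreal (indicator {0<..} z / z\<^sup>2) * indicator {a..} z \<partial>lborel)"
    using nn_integral_pareto_intensity[of "indicator {a..}"] by simp
  also have "\<dots> = (\<integral>\<^sup>+z. ennreal (1 / z\<^sup>2) * indicator {a..} z \<partial>lborel)"
    using assms by (intro nn_integral_cong) (auto simp: indicator_def)
  also have "\<dots> = ennreal (0 - (- 1 / a))"
  proof (rule nn_integral_FTC_atLeast)
    show "DERIV (\<lambda>z. - 1 / z) x :> 1 / x\<^sup>2" if "a \<le> x" for x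
      using that assms by (auto intro!: derivative_eq_intros simp: power2_eq_square)
    show "((\<lambda>z::real. - 1 / z) \<longlongrightarrow> 0) at_top"
      by (rule tendsto_divide_0[OF tendsto_const filterlim_at_top_imp_at_infinity[OF filterlim_ident]])
  qed auto
  finally show ?thesis by simp
qed

lemma emeasure_pareto_intensity_greaterThan:
  assumes "0 < a"
  shows "emeasure pareto_intensity {a<..} = ennreal (1 / a)"
proof -
  have "emeasure pareto_intensity {a<..} = emeasure pareto_intensity {a..}"
    using AE_pareto_intensity_neq[of a] by (intro emeasure_eq_AE) (auto elim!: eventually_mono)
  then show ?thesis by (simp add: emeasure_pareto_intensity_atLeast assms)
qed

lemma emeasure_pareto_intensity_Ioi_0: "emeasure pareto_intensity {0<..} = \<top>"
proof -
  have "of_nat n \<le> emeasure pareto_intensity {0<..}" for n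
  proof (cases "n = 0")
    case False
    then have "of_nat n = emeasure pareto_intensity {1 / real n..}"
      by (simp add: emeasure_pareto_intensity_atLeast ennreal_of_nat_eq_real_of_nat)
    also have "\<dots> \<le> emeasure pareto_intensity {0<..}"
      using False by (intro emeasure_mono) (auto intro: less_le_trans[rotated])
    finally show ?thesis .
  qed simp
  then have "(\<Squnion>n. of_nat n) \<le> emeasure pareto_intensity {0<..}"
    by (rule SUP_least)
  then show ?thesis by (simp add: ennreal_SUP_of_nat_eq_top top_unique)
qed

lemma emeasure_pareto_intensity_scaled_gt_1: "emeasure pareto_intensity {z. 1 < ennreal z * m} = m"
proof (cases m)
  case top
  then have "{z. 1 < ennreal z * m} = {0<..}"
    by (auto simp: ennreal_mult_top ennreal_eq_0_iff)
  with top show ?thesis by (simp add: emeasure_pareto_intensity_Ioi_0)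
next
  case (real x)
  show ?thesis
  proof (cases "x = 0")
    case False
    then have "{z. 1 < ennreal z * m} = {1 / x<..}"
      using real by (auto simp: field_simps simp flip: ennreal_mult'')
    then show ?thesis
      using False real by (simp add: emeasure_pareto_intensity_greaterThan)
  qed (use real in simp)
qed

lemma emeasure_pareto_intensity_scaled_ge_1:
  assumes "0 \<le> m"
  shows "emeasure pareto_intensity {z. 1 \<le> z * m} = ennreal m"
proof (cases "m = 0")
  case False
  then have "{z. 1 \<le> z * m} = {1 / m..}"
    using assms by (auto simp: field_simps)
  then show ?thesis
    using False assms by (simp add: emeasure_pareto_intensity_atLeast)
qed simp

lemma nn_integral_pareto_intensity_rescale:
  assumes [measurable]: "F \<in> borel_measurable borel" and c: "0 < c"
  shows "(\<integral>\<^sup>+z. F z \<partial>pareto_intensity) = ennreal c * (\<integral>\<^sup>+z. F (z / c) \<partial>pareto_intensity)"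
proof -
  have "(\<integral>\<^sup>+z. F z \<partial>pareto_intensity)
      = ennreal (1 / c) * (\<integral>\<^sup>+z. ennreal (indicator {0<..} (z / c) / (z / c)\<^sup>2) * F (z / c) \<partial>lborel)"
    unfolding nn_integral_pareto_intensity[OF assms(1)]
    by (subst nn_integral_real_affine[where c = "1 / c" and t = 0]) (use c in auto)
  also have "\<dots> = ennreal (1 / c)
      * (\<integral>\<^sup>+z. ennreal (c\<^sup>2) * (ennreal (indicator {0<..} z / z\<^sup>2) * F (z / c)) \<partial>lborel)"
  proof -
    have "ennreal (indicator {0<..} (z / c) / (z / c)\<^sup>2)
        = ennreal (c\<^sup>2) * ennreal (indicator {0<..} z / z\<^sup>2)" for z
      using c by (auto simp: indicator_def ennreal_mult[symmetric] power_divide zero_less_divide_iff)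
    then show ?thesis by (simp add: mult.assoc)
  qed
  also have "\<dots> = ennreal (1 / c) * ennreal (c\<^sup>2) * (\<integral>\<^sup>+z. F (z / c) \<partial>pareto_intensity)"
    by (simp add: nn_integral_cmult nn_integral_pareto_intensity mult.assoc)
  also have "ennreal (1 / c) * ennreal (c\<^sup>2) = ennreal c"
    using c by (simp add: ennreal_mult[symmetric] power2_eq_square)
  finally show ?thesis .
qed

lemma unit_pareto_distr:
  assumes "prob_space M" "unit_pareto M R"
  shows "distr M borel R = density pareto_intensity (indicator {1<..})"
proof (rule measure_eqI_lessThan)
  interpret prob_space M by fact
  have [measurable]: "R \<in> borel_measurable M"
    and tail: "\<And>x. 1 \<le> x \<Longrightarrow> prob {\<omega>\<in>space M. x < R \<omega>} = 1 / x"
    using assms(2) by (auto simp: unit_pareto_def)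
  have tail_max: "prob {\<omega>\<in>space M. x < R \<omega>} = 1 / max x 1" for x
  proof (cases "1 \<le> x")
    case False
    have "prob {\<omega>\<in>space M. 1 < R \<omega>} \<le> prob {\<omega>\<in>space M. x < R \<omega>}"
      using False by (intro finite_measure_mono) auto
    then show ?thesis
      using False tail[of 1] prob_le_1[of "{\<omega>\<in>space M. x < R \<omega>}"] by (simp add: max_def)
  qed (simp add: tail max_absorb1)
  have emeasure_distr_R: "emeasure (distr M borel R) {x<..} = ennreal (1 / max x 1)" for x
  proof -
    have "R -` {x<..} \<inter> space M = {\<omega>\<in>space M. x < R \<omega>}" by auto
    then show ?thesis by (simp add: emeasure_distr emeasure_eq_measure tail_max)
  qed
  then show "emeasure (distr M borel R) {x<..} < \<infinity>" for x
    by simp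
  have "emeasure (density pareto_intensity (indicator {1<..})) {x<..}
      = emeasure pareto_intensity {max x 1<..}" for x
    by (subst emeasure_restricted) (auto intro!: arg_cong[where f = "emeasure pareto_intensity"])
  then show "emeasure (distr M borel R) {x<..}
      = emeasure (density pareto_intensity (indicator {1<..})) {x<..}" for x
    by (simp add: emeasure_distr_R emeasure_pareto_intensity_greaterThan)
qed simp_all

definition exponent_measure :: "'a measure \<Rightarrow> ('a \<Rightarrow> 'd::finite field) \<Rightarrow> 'd field measure" where
  "exponent_measure M Z = distr (M \<Otimes>\<^sub>M pareto_intensity) PE (\<lambda>(\<omega>, z) t. z * Z \<omega> t)"

lemma sets_exponent_measure [simp, measurable_cong]: "sets (exponent_measure M Z) = sets PE"
  by (simp add: exponent_measure_def)

lemma space_exponent_measure [simp]: "space (exponent_measure M Z) = UNIV"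
  by (simp add: exponent_measure_def)

lemma measurable_scaled_field:
  assumes "Z \<in> measurable N PE" "sets K = sets borel"
  shows "(\<lambda>(\<omega>, z) t. z * Z \<omega> t) \<in> measurable (N \<Otimes>\<^sub>M K) (PE :: 'd::finite field measure)"
proof (rule measurable_PEI)
  fix t
  note [measurable_cong] = assms(2)
  have [measurable]: "(\<lambda>\<omega>. Z \<omega> t) \<in> borel_measurable N"
    by (rule measurable_PE_coord_compose[OF assms(1)])
  show "(\<lambda>p. (case p of (\<omega>, z) \<Rightarrow> \<lambda>t. z * Z \<omega> t) t) \<in> borel_measurable (N \<Otimes>\<^sub>M K)"
    by (simp add: case_prod_beta)
qed

lemma nn_integral_exponent_measure:
  assumes "Z \<in> measurable M PE" and [measurable]: "F \<in> borel_measurable PE"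
  shows "(\<integral>\<^sup>+f. F f \<partial>exponent_measure M Z) = (\<integral>\<^sup>+\<omega>. \<integral>\<^sup>+z. F (\<lambda>t. z * Z \<omega> t) \<partial>pareto_intensity \<partial>M)"
proof -
  note [measurable] = measurable_scaled_field[OF assms(1) sets_pareto_intensity]
  have "(\<integral>\<^sup>+f. F f \<partial>exponent_measure M Z)
      = (\<integral>\<^sup>+p. F ((\<lambda>(\<omega>, z) t. z * Z \<omega> t) p) \<partial>(M \<Otimes>\<^sub>M pareto_intensity))"
    unfolding exponent_measure_def by (rule nn_integral_distr) measurable
  also have "\<dots> = (\<integral>\<^sup>+\<omega>. \<integral>\<^sup>+z. F ((\<lambda>(\<omega>, z) t. z * Z \<omega> t) (\<omega>, z)) \<partial>pareto_intensity \<partial>M)"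
    by (rule pareto_intensity.nn_integral_fst[symmetric]) measurable
  finally show ?thesis by simp
qed

lemma AE_exponent_measureI:
  assumes "sigma_finite_measure M" "Z \<in> measurable M PE" and [measurable]: "Measurable.pred PE Q"
    and AE_scaled: "AE \<omega> in M. AE z in pareto_intensity. Q (\<lambda>t. z * Z \<omega> t)"
  shows "AE f in exponent_measure M Z. Q f"
proof -
  interpret pair_sigma_finite M pareto_intensity
    by (intro pair_sigma_finite.intro assms(1) pareto_intensity.sigma_finite_measure_axioms)
  note [measurable] = measurable_scaled_field[OF assms(2) sets_pareto_intensity]
  have "AE p in M \<Otimes>\<^sub>M pareto_intensity. Q ((\<lambda>(\<omega>, z) t. z * Z \<omega> t) p)"
    by (rule AE_pair_measure) (measurable, use AE_scaled in simp)
  then show ?thesis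
    unfolding exponent_measure_def by (subst AE_distr_iff) (simp_all add: Collect_in_sets_PE)
qed

lemma nn_integral_exponent_measure_homogeneous:
  assumes Z: "Z \<in> measurable M PE" and [measurable]: "h \<in> borel_measurable PE"
    and homogeneous: "\<And>f c. 0 < c \<Longrightarrow> h (\<lambda>t. c * f t) = h f"
  shows "(\<integral>\<^sup>+f. h f * indicator {f. 1 < Mx f} f \<partial>exponent_measure M Z) = (\<integral>\<^sup>+\<omega>. h (Z \<omega>) * Mx (Z \<omega>) \<partial>M)"
proof -
  have [measurable]: "{f. 1 < Mx f} \<in> sets (PE :: 'b field measure)"
    by (rule Collect_in_sets_PE) measurable
  have radial_integral: "(\<integral>\<^sup>+z. h (\<lambda>t. z * f t) * indicator {f. 1 < Mx f} (\<lambda>t. z * f t) \<partial>pareto_intensity)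
      = h f * Mx f" for f
  proof -
    have "(\<integral>\<^sup>+z. h (\<lambda>t. z * f t) * indicator {f. 1 < Mx f} (\<lambda>t. z * f t) \<partial>pareto_intensity)
        = (\<integral>\<^sup>+z. h f * indicator {z. 1 < ennreal z * Mx f} z \<partial>pareto_intensity)"
      by (intro nn_integral_cong_AE AE_pareto_intensityI) (simp add: homogeneous Mx_scale indicator_def)
    also have "\<dots> = h f * Mx f"
      by (subst nn_integral_cmult_indicator) (simp_all add: emeasure_pareto_intensity_scaled_gt_1)
    finally show ?thesis .
  qed
  have "(\<integral>\<^sup>+f. h f * indicator {f. 1 < Mx f} f \<partial>exponent_measure M Z)
      = (\<integral>\<^sup>+\<omega>. \<integral>\<^sup>+z. h (\<lambda>t. z * Z \<omega> t) * indicator {f. 1 < Mx f} (\<lambda>t. z * Z \<omega> t) \<partial>pareto_intensity \<partial>M)"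
    by (rule nn_integral_exponent_measure[OF Z]) measurable
  then show ?thesis by (simp only: radial_integral)
qed

lemma nn_integral_pareto_intensity_Compl_strictly_below:
  assumes f: "\<forall>t. 0 \<le> f t" and T: "finite T" "T \<noteq> {}" and x: "\<forall>t\<in>T. 0 < x t"
  shows "(\<integral>\<^sup>+z. indicator (- strictly_below T x) (\<lambda>t. z * f t) \<partial>pareto_intensity)
    = ennreal (Max ((\<lambda>t. f t / x t) ` T))"
proof -
  let ?m = "Max ((\<lambda>t. f t / x t) ` T)"
  have "(\<lambda>t. z * f t) \<in> - strictly_below T x \<longleftrightarrow> 1 \<le> z * ?m" if "0 < z" for z
  proof -
    have "1 \<le> z * ?m \<longleftrightarrow> 1 / z \<le> ?m"
      using that by (simp add: field_simps)
    also have "\<dots> \<longleftrightarrow> (\<exists>t\<in>T. 1 / z \<le> f t / x t)"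
      using T by (simp add: Max_ge_iff)
    also have "\<dots> \<longleftrightarrow> (\<exists>t\<in>T. x t \<le> z * f t)"
      using that x by (intro bex_cong refl) (auto simp: field_simps)
    finally show ?thesis by (simp add: strictly_below_def not_less)
  qed
  then have "(\<integral>\<^sup>+z. indicator (- strictly_below T x) (\<lambda>t. z * f t) \<partial>pareto_intensity)
      = (\<integral>\<^sup>+z. indicator {z. 1 \<le> z * ?m} z \<partial>pareto_intensity)"
    by (intro nn_integral_cong_AE AE_pareto_intensityI) (simp only: indicator_def mem_Collect_eq)
  also have "\<dots> = emeasure pareto_intensity {z. 1 \<le> z * ?m}"
    by (rule nn_integral_indicator) simp
  also have "\<dots> = ennreal ?m"
    using T x f
    by (intro emeasure_pareto_intensity_scaled_ge_1) (auto simp: Max_ge_iff intro!: divide_nonneg_pos)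
  finally show ?thesis .
qed

lemma emeasure_exponent_measure_Compl_strictly_below:
  assumes Z: "Z \<in> measurable M PE"
    and nonneg: "\<And>\<omega> t. \<omega> \<in> space M \<Longrightarrow> 0 \<le> Z \<omega> t"
    and T: "finite T" "T \<noteq> {}" and x: "\<forall>t\<in>T. 0 < x t"
  shows "emeasure (exponent_measure M Z) (- strictly_below T x)
    = (\<integral>\<^sup>+\<omega>. ennreal (Max ((\<lambda>t. Z \<omega> t / x t) ` T)) \<partial>M)"
proof -
  note [measurable] = Compl_strictly_below_in_sets[OF T(1)]
  have "emeasure (exponent_measure M Z) (- strictly_below T x)
      = (\<integral>\<^sup>+f. indicator (- strictly_below T x) f \<partial>exponent_measure M Z)"
    by simp
  also have "\<dots> = (\<integral>\<^sup>+\<omega>. \<integral>\<^sup>+z. indicator (- strictly_below T x) (\<lambda>t. z * Z \<omega> t) \<partial>pareto_intensity \<partial>M)"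
    by (rule nn_integral_exponent_measure[OF Z]) measurable
  also have "\<dots> = (\<integral>\<^sup>+\<omega>. ennreal (Max ((\<lambda>t. Z \<omega> t / x t) ` T)) \<partial>M)"
    by (intro nn_integral_cong nn_integral_pareto_intensity_Compl_strictly_below T x) (simp add: nonneg)
  finally show ?thesis .
qed

locale max_stable_spectral = prob_space M for M :: "'a measure" +
  fixes X Z :: "'a \<Rightarrow> 'd::finite field"
  assumes stationary: "stationary M X" and spectral: "spectral_rf M X Z"
begin

lemma measurable_Z: "Z \<in> measurable M PE"
  using spectral by (simp add: spectral_rf_def)

lemma measurable_Z_coord [measurable]: "(\<lambda>\<omega>. Z \<omega> t) \<in> borel_measurable M"
  by (rule measurable_PE_coord_compose[OF measurable_Z])

lemma Z_nonneg: "\<omega> \<in> space M \<Longrightarrow> 0 \<le> Z \<omega> t"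
  using spectral by (simp add: spectral_rf_def)

lemma integrable_Z: "integrable M (\<lambda>\<omega>. Z \<omega> t)" and expectation_Z: "expectation (\<lambda>\<omega>. Z \<omega> t) = 1"
  using spectral by (simp_all add: spectral_rf_def)

lemma nn_integral_Z: "(\<integral>\<^sup>+\<omega>. ennreal (Z \<omega> t) \<partial>M) = 1"
  using nn_integral_eq_integral[OF integrable_Z] by (simp add: expectation_Z Z_nonneg)

definition \<nu> :: "'d field measure" where
  "\<nu> = exponent_measure M Z"

lemma sets_nu [simp, measurable_cong]: "sets \<nu> = sets PE"
  by (simp add: \<nu>_def)

lemma AE_nuI:
  assumes "Measurable.pred PE Q" "AE \<omega> in M. AE z in pareto_intensity. Q (\<lambda>t. z * Z \<omega> t)"
  shows "AE f in \<nu>. Q f"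
  unfolding \<nu>_def using assms by (intro AE_exponent_measureI measurable_Z sigma_finite_measure_axioms)

lemma Max_scaled_Z_nonneg:
  assumes "finite T" "T \<noteq> {}" "\<forall>t\<in>T. 0 < x t" "\<omega> \<in> space M"
  shows "0 \<le> Max ((\<lambda>t. Z \<omega> t / x t) ` T)"
  using assms Z_nonneg[OF assms(4)] by (auto simp: Max_ge_iff intro!: divide_nonneg_pos)

lemma integrable_Max_scaled_Z:
  assumes "finite T" "T \<noteq> {}" "\<forall>t\<in>T. 0 < x t"
  shows "integrable M (\<lambda>\<omega>. Max ((\<lambda>t. Z \<omega> t / x t) ` T))"
proof (rule Bochner_Integration.integrable_bound)
  show "integrable M (\<lambda>\<omega>. \<Sum>t\<in>T. Z \<omega> t / x t)"
    by (intro Bochner_Integration.integrable_sum integrable_divide integrable_Z)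
  show "(\<lambda>\<omega>. Max ((\<lambda>t. Z \<omega> t / x t) ` T)) \<in> borel_measurable M"
    using assms(1) by (intro borel_measurable_Max) measurable
  show "AE \<omega> in M. norm (Max ((\<lambda>t. Z \<omega> t / x t) ` T)) \<le> norm (\<Sum>t\<in>T. Z \<omega> t / x t)"
  proof (rule AE_I2)
    fix \<omega> assume \<omega>: "\<omega> \<in> space M"
    have "0 \<le> Z \<omega> t / x t" if "t \<in> T" for t
      using Z_nonneg[OF \<omega>, of t] assms(3) that by (auto intro!: divide_nonneg_pos)
    then have "Max ((\<lambda>t. Z \<omega> t / x t) ` T) \<le> (\<Sum>t\<in>T. Z \<omega> t / x t)"
      using assms(1,2) by (auto intro!: member_le_sum)
    then show "norm (Max ((\<lambda>t. Z \<omega> t / x t) ` T)) \<le> norm (\<Sum>t\<in>T. Z \<omega> t / x t)"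
      using Max_scaled_Z_nonneg[OF assms \<omega>] by simp
  qed
qed

lemma emeasure_nu_Compl_strictly_below:
  assumes "finite T" "T \<noteq> {}" "\<forall>t\<in>T. 0 < x t"
  shows "emeasure \<nu> (- strictly_below T x) = ennreal (\<integral>\<omega>. Max ((\<lambda>t. Z \<omega> t / x t) ` T) \<partial>M)"
proof -
  have "emeasure \<nu> (- strictly_below T x) = (\<integral>\<^sup>+\<omega>. ennreal (Max ((\<lambda>t. Z \<omega> t / x t) ` T)) \<partial>M)"
    unfolding \<nu>_def
    by (rule emeasure_exponent_measure_Compl_strictly_below[OF measurable_Z]) (auto simp: Z_nonneg assms)
  also have "\<dots> = ennreal (\<integral>\<omega>. Max ((\<lambda>t. Z \<omega> t / x t) ` T) \<partial>M)"
    using Max_scaled_Z_nonneg[OF assms] by (intro nn_integral_eq_integral integrable_Max_scaled_Z assms) auto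
  finally show ?thesis .
qed

lemma expectation_Max_translate:
  assumes "finite T" "T \<noteq> {}" "\<forall>t\<in>T. 0 < x t"
  shows "(\<integral>\<omega>. Max ((\<lambda>t. Z \<omega> t / x (t + h)) ` (\<lambda>t. t - h) ` T) \<partial>M) = (\<integral>\<omega>. Max ((\<lambda>t. Z \<omega> t / x t) ` T) \<partial>M)"
proof -
  have [measurable]: "X \<in> measurable M PE"
    and X_shift: "distr M PE (\<lambda>\<omega>. shift h (X \<omega>)) = distr M PE X"
    using stationary by (simp_all add: stationary_def)
  have exponent: "prob {\<omega>\<in>space M. \<forall>t\<in>T. X \<omega> t \<le> x t} = exp (- (\<integral>\<omega>. Max ((\<lambda>t. Z \<omega> t / x t) ` T) \<partial>M))"
    if "finite T" "T \<noteq> {}" "\<forall>t\<in>T. 0 < x t" for T x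
    using spectral that by (simp add: spectral_rf_def)
  have event: "{f. \<forall>t\<in>T. f t \<le> x t} \<in> sets PE"
    using assms(1) by (intro Collect_in_sets_PE) measurable
  have "prob {\<omega>\<in>space M. \<forall>t\<in>T. shift h (X \<omega>) t \<le> x t}
      = measure (distr M PE (\<lambda>\<omega>. shift h (X \<omega>))) {f. \<forall>t\<in>T. f t \<le> x t}"
    using event by (subst measure_distr) (auto intro!: arg_cong[where f = prob])
  also have "\<dots> = prob {\<omega>\<in>space M. \<forall>t\<in>T. X \<omega> t \<le> x t}"
    unfolding X_shift using event by (subst measure_distr) (auto intro!: arg_cong[where f = prob])
  finally have "prob {\<omega>\<in>space M. \<forall>t\<in>(\<lambda>t. t - h) ` T. X \<omega> t \<le> x (t + h)} = prob {\<omega>\<in>space M. \<forall>t\<in>T. X \<omega> t \<le> x t}"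
    by (simp add: shift_def)
  then show ?thesis
    using exponent[OF assms] exponent[of "(\<lambda>t. t - h) ` T" "\<lambda>t. x (t + h)"] assms by simp
qed

lemma AE_nu_nonneg: "AE f in \<nu>. \<forall>t. 0 \<le> f t"
  by (rule AE_nuI) (auto intro!: AE_I2 AE_pareto_intensityI mult_nonneg_nonneg Z_nonneg)

lemma AE_nu_nonzero: "AE f in \<nu>. \<exists>t. 0 < f t"
proof (rule AE_nuI)
  have "AE \<omega> in M. \<exists>t. 0 < Z \<omega> t"
    using spectral by (simp add: spectral_rf_def)
  then show "AE \<omega> in M. AE z in pareto_intensity. \<exists>t. 0 < z * Z \<omega> t"
    by eventually_elim (auto intro!: AE_pareto_intensityI simp: zero_less_mult_iff)
qed measurable

lemma AE_nu_neq_1: "AE f in \<nu>. \<forall>t. f t \<noteq> 1"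
proof (rule AE_nuI)
  have "AE z in pareto_intensity. z * Z \<omega> t \<noteq> 1" for \<omega> t
    using AE_pareto_intensity_neq[of "1 / Z \<omega> t"]
    by eventually_elim (auto simp: eq_divide_eq split: if_splits)
  then show "AE \<omega> in M. AE z in pareto_intensity. \<forall>t. z * Z \<omega> t \<noteq> 1"
    by (simp add: AE_all_countable)
qed measurable

lemma emeasure_nu_exceedance:
  assumes "finite T" "T \<noteq> {}"
  shows "emeasure \<nu> {f. \<exists>t\<in>T. 1 < f t} = ennreal (\<integral>\<omega>. Max (Z \<omega> ` T) \<partial>M)"
proof -
  have "emeasure \<nu> {f. \<exists>t\<in>T. 1 < f t} = emeasure \<nu> (- strictly_below T (\<lambda>_. 1))"
  proof (rule emeasure_eq_AE)
    show "AE f in \<nu>. f \<in> {f. \<exists>t\<in>T. 1 < f t} \<longleftrightarrow> f \<in> - strictly_below T (\<lambda>_. 1)"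
      using AE_nu_neq_1 by eventually_elim (auto simp: strictly_below_def not_less le_less)
  qed (use assms in \<open>auto intro!: Collect_in_sets_PE Compl_strictly_below_in_sets\<close>)
  then show ?thesis
    using emeasure_nu_Compl_strictly_below[OF assms, of "\<lambda>_. 1"] by simp
qed

lemma distr_nu_shift: "distr \<nu> PE (shift h) = \<nu>"
proof (rule field_measure_eqI[symmetric])
  have events: "{f::'d field. \<forall>t. 0 \<le> f t} \<in> sets PE" "{f::'d field. \<exists>t. 0 < f t} \<in> sets PE"
    by (auto intro!: Collect_in_sets_PE)
  show "AE f in distr \<nu> PE (shift h). \<forall>t. 0 \<le> f t"
    using AE_nu_nonneg events by (subst AE_distr_iff) (auto elim!: eventually_mono simp: shift_def)
  have "(\<exists>t. 0 < f t) \<Longrightarrow> (\<exists>t. 0 < f (t - h))" for f :: "'d field"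
    by (metis add_diff_cancel_right')
  then show "AE f in distr \<nu> PE (shift h). \<exists>t. 0 < f t"
    using AE_nu_nonzero events by (subst AE_distr_iff) (auto elim!: eventually_mono simp: shift_def)
  fix T :: "(int ^ 'd) set" and x :: "'d field"
  assume T: "finite T" and x: "\<forall>t\<in>T. 0 < x t"
  show "emeasure \<nu> (- strictly_below T x) < \<top>"
    using emeasure_nu_Compl_strictly_below[OF T _ x] by (cases "T = {}") (auto simp: strictly_below_def)
  have "shift h -` (- strictly_below T x) = - strictly_below ((\<lambda>t. t - h) ` T) (\<lambda>t. x (t + h))"
    by (auto simp: strictly_below_def shift_def)
  then have "emeasure (distr \<nu> PE (shift h)) (- strictly_below T x)
      = emeasure \<nu> (- strictly_below ((\<lambda>t. t - h) ` T) (\<lambda>t. x (t + h)))"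
    using Compl_strictly_below_in_sets[OF T] by (subst emeasure_distr) (auto simp: \<nu>_def)
  also have "\<dots> = emeasure \<nu> (- strictly_below T x)"
  proof (cases "T = {}")
    case False
    then show ?thesis
      using T x by (simp add: emeasure_nu_Compl_strictly_below expectation_Max_translate)
  qed (simp add: strictly_below_def)
  finally show "emeasure \<nu> (- strictly_below T x) = emeasure (distr \<nu> PE (shift h)) (- strictly_below T x)" ..
qed (use AE_nu_nonneg AE_nu_nonzero in auto)

lemma nn_integral_peak_share_le_1:
  "(\<integral>\<^sup>+f. ennreal (f 0) / Mx f * indicator {f. 1 < Mx f} f \<partial>\<nu>) \<le> 1"
proof -
  have "(\<integral>\<^sup>+f. ennreal (f 0) / Mx f * indicator {f. 1 < Mx f} f \<partial>\<nu>)
      = (\<integral>\<^sup>+\<omega>. ennreal (Z \<omega> 0) / Mx (Z \<omega>) * Mx (Z \<omega>) \<partial>M)"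
    unfolding \<nu>_def
    by (rule nn_integral_exponent_measure_homogeneous[OF measurable_Z])
       (simp_all add: Mx_scale ennreal_mult' ennreal_scale_divide)
  also have "\<dots> \<le> (\<integral>\<^sup>+\<omega>. ennreal (Z \<omega> 0) \<partial>M)"
    by (intro nn_integral_mono) (simp add: ennreal_divide_times_self_le)
  finally show ?thesis by (simp add: nn_integral_Z)
qed

sublocale tail_measure \<nu>
proof
  show "emeasure \<nu> {f. 1 < f 0} = 1"
    using emeasure_nu_exceedance[of "{0}"] by (simp add: expectation_Z)
  show "AE f in \<nu>. f 0 \<noteq> 1"
    using AE_nu_neq_1 by eventually_elim simp
  show "(\<integral>\<^sup>+f. ennreal (f 0) / Mx f * indicator {f. 1 < Mx f} f \<partial>\<nu>) < \<top>"
    using nn_integral_peak_share_le_1 by (rule le_less_trans) simp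
qed (simp_all add: distr_nu_shift AE_nu_nonneg)

lemma ext_seq_eq_cube_exceedance_rate: "ext_seq M Z = cube_exceedance_rate"
proof
  fix n
  have "cube n \<noteq> ({} :: (int ^ 'd) set)"
    unfolding cube_def by (auto intro!: exI[of _ 0])
  then show "ext_seq M Z n = cube_exceedance_rate n"
    using Max_scaled_Z_nonneg[of "cube n" "\<lambda>_. 1"]
    by (simp add: ext_seq_def cube_exceedance_rate_def measure_def emeasure_nu_exceedance
        finite_int_box cube_eq_int_box integral_nonneg_AE)
qed

lemma ext_seq_tendsto: "ext_seq M Z \<longlonglongrightarrow> extremal_index"
  unfolding ext_seq_eq_cube_exceedance_rate by (rule cube_exceedance_rate_tendsto)

lemma nn_integral_Z_mass_share:
  "(\<integral>\<^sup>+\<omega>. ennreal (Z \<omega> 0 * ratio_enn (Mx (Z \<omega>)) (Ssum (Z \<omega>))) \<partial>M) = ennreal extremal_index"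
proof -
  have "ennreal extremal_index = (\<integral>\<^sup>+f. ennreal (f 0) / Ssum f * indicator {f. 1 < Mx f} f \<partial>\<nu>)"
    by (rule nn_integral_mass_share[symmetric])
  also have "\<dots> = (\<integral>\<^sup>+\<omega>. ennreal (Z \<omega> 0) / Ssum (Z \<omega>) * Mx (Z \<omega>) \<partial>M)"
    unfolding \<nu>_def
    by (rule nn_integral_exponent_measure_homogeneous[OF measurable_Z])
       (simp_all add: Ssum_scale ennreal_mult' ennreal_scale_divide)
  also have "\<dots> = (\<integral>\<^sup>+\<omega>. ennreal (Z \<omega> 0 * ratio_enn (Mx (Z \<omega>)) (Ssum (Z \<omega>))) \<partial>M)"
    by (intro nn_integral_cong) (simp add: ennreal_mass_share Z_nonneg)
  finally show ?thesis ..
qed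

lemma expectation_Z_mass_share: "(\<integral>\<omega>. Z \<omega> 0 * ratio_enn (Mx (Z \<omega>)) (Ssum (Z \<omega>)) \<partial>M) = extremal_index"
proof -
  note [measurable] = measurable_Z
  show ?thesis
    by (subst integral_eq_nn_integral)
       (auto simp: nn_integral_Z_mass_share extremal_index_nonneg
         intro!: AE_I2 mult_nonneg_nonneg Z_nonneg ratio_enn_nonneg)
qed

end

section \<open>The spectral tail field\<close>

definition pareto_average :: "('d::finite field \<Rightarrow> ennreal) \<Rightarrow> 'd field \<Rightarrow> ennreal" where
  "pareto_average F f = (\<integral>\<^sup>+z. indicator {1<..} z * F (\<lambda>t. z * f t) \<partial>pareto_intensity)"

lemma measurable_pareto_average [measurable]:
  fixes F :: "'d::finite field \<Rightarrow> ennreal"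
  assumes [measurable]: "F \<in> borel_measurable PE"
  shows "pareto_average F \<in> borel_measurable PE"
proof -
  note [measurable] = measurable_scaled_field[OF measurable_ident sets_pareto_intensity, unfolded id_def]
  have "(\<lambda>(f, z). indicator {1<..} z * F ((\<lambda>(f, z) t. z * f t) (f, z)))
      \<in> borel_measurable (PE \<Otimes>\<^sub>M pareto_intensity)"
    by measurable
  then show ?thesis
    unfolding pareto_average_def[abs_def]
    by (intro pareto_intensity.borel_measurable_nn_integral) simp
qed

lemma pareto_average_normalized:
  fixes F :: "'d::finite field \<Rightarrow> ennreal"
  assumes F: "F \<in> borel_measurable PE" and "0 \<le> f 0"
  shows "ennreal (f 0) * pareto_average F (\<lambda>t. f t / f 0)
    = (\<integral>\<^sup>+z. indicator {1<..} (z * f 0) * F (\<lambda>t. z * f t) \<partial>pareto_intensity)"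
proof (cases "f 0 = 0")
  case False
  with assms(2) have pos: "0 < f 0" by simp
  have "(\<lambda>z t. z * f t) \<in> measurable borel PE"
    by (rule measurable_PEI) measurable
  then have [measurable]: "(\<lambda>z. F (\<lambda>t. z * f t)) \<in> borel_measurable borel"
    by (rule measurable_compose) (rule F)
  show ?thesis
    using pos nn_integral_pareto_intensity_rescale[OF _ pos,
        of "\<lambda>z. indicator {1<..} (z * f 0) * F (\<lambda>t. z * f t)"]
    by (simp add: pareto_average_def)
qed simp

lemma (in prob_space) AE_imp_if_prob_conj_eq:
  assumes "Measurable.pred M P" "Measurable.pred M Q"
    and eq: "prob {\<omega>\<in>space M. P \<omega> \<and> Q \<omega>} = prob {\<omega>\<in>space M. Q \<omega>}"
  shows "AE \<omega> in M. Q \<omega> \<longrightarrow> P \<omega>"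
proof -
  note [measurable] = assms(1,2)
  have "{\<omega>\<in>space M. Q \<omega> \<and> \<not> P \<omega>} = {\<omega>\<in>space M. Q \<omega>} - {\<omega>\<in>space M. P \<omega> \<and> Q \<omega>}"
    by auto
  then have "prob {\<omega>\<in>space M. Q \<omega> \<and> \<not> P \<omega>} = prob {\<omega>\<in>space M. Q \<omega>} - prob {\<omega>\<in>space M. P \<omega> \<and> Q \<omega>}"
    by (simp add: finite_measure_Diff subset_eq)
  then have "prob {\<omega>\<in>space M. Q \<omega> \<and> \<not> P \<omega>} = 0"
    by (simp add: eq)
  then have "AE \<omega> in M. \<not> (Q \<omega> \<and> \<not> P \<omega>)"
    by (subst (asm) prob_Collect_eq_0) measurable
  then show ?thesis by eventually_elim blast
qed

locale max_stable_tail = max_stable_spectral M X Z for M :: "'a measure" and X Z :: "'a \<Rightarrow> 'd::finite field" +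
  fixes Th :: "'a \<Rightarrow> 'd field" and R :: "'a \<Rightarrow> real"
  assumes spectral_tail: "spectral_tail M Z Th" and unit_pareto: "unit_pareto M R"
    and indep: "\<And>A B. A \<in> sets borel \<Longrightarrow> B \<in> sets PE \<Longrightarrow>
      measure M {\<omega>\<in>space M. R \<omega> \<in> A \<and> Th \<omega> \<in> B}
        = measure M {\<omega>\<in>space M. R \<omega> \<in> A} * measure M {\<omega>\<in>space M. Th \<omega> \<in> B}"
begin

lemma measurable_Th [measurable]: "Th \<in> measurable M PE"
  using spectral_tail by (simp add: spectral_tail_def)

lemma measurable_R [measurable]: "R \<in> borel_measurable M"
  using unit_pareto by (simp add: unit_pareto_def)

lemma measurable_normalized_Z [measurable]: "(\<lambda>\<omega> t. Z \<omega> t / Z \<omega> 0) \<in> measurable M PE"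
  by (rule measurable_PEI) measurable

lemma distr_Th:
  "distr M PE Th = distr (density M (\<lambda>\<omega>. ennreal (Z \<omega> 0))) PE (\<lambda>\<omega> t. Z \<omega> t / Z \<omega> 0)"
proof (rule measure_eqI)
  fix A assume "A \<in> sets (distr M PE Th)"
  then have [measurable]: "A \<in> sets PE" by simp
  have "emeasure (distr M PE Th) A = ennreal (prob {\<omega>\<in>space M. Th \<omega> \<in> A})"
    by (auto simp: emeasure_distr emeasure_eq_measure intro!: arg_cong[where f = prob])
  also have "\<dots> = ennreal (\<integral>\<omega>. Z \<omega> 0 * indicator A (\<lambda>t. Z \<omega> t / Z \<omega> 0) \<partial>M)"
    using spectral_tail by (simp add: spectral_tail_def)
  also have "\<dots> = (\<integral>\<^sup>+\<omega>. ennreal (Z \<omega> 0 * indicator A (\<lambda>t. Z \<omega> t / Z \<omega> 0)) \<partial>M)"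
  proof (rule nn_integral_eq_integral[symmetric])
    show "integrable M (\<lambda>\<omega>. Z \<omega> 0 * indicator A (\<lambda>t. Z \<omega> t / Z \<omega> 0))"
      by (rule Bochner_Integration.integrable_bound[OF integrable_Z[of 0]]) (auto simp: indicator_def)
  qed (auto simp: Z_nonneg)
  also have "\<dots> = (\<integral>\<^sup>+\<omega>. ennreal (Z \<omega> 0) * indicator ((\<lambda>\<omega> t. Z \<omega> t / Z \<omega> 0) -` A \<inter> space M) \<omega> \<partial>M)"
    by (intro nn_integral_cong) (auto simp: indicator_def)
  also have "\<dots> = emeasure (density M (\<lambda>\<omega>. ennreal (Z \<omega> 0))) ((\<lambda>\<omega> t. Z \<omega> t / Z \<omega> 0) -` A \<inter> space M)"
    by (rule emeasure_density[symmetric]) measurable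
  also have "\<dots> = emeasure (distr (density M (\<lambda>\<omega>. ennreal (Z \<omega> 0))) PE (\<lambda>\<omega> t. Z \<omega> t / Z \<omega> 0)) A"
    by (simp add: emeasure_distr)
  finally show "emeasure (distr M PE Th) A
      = emeasure (distr (density M (\<lambda>\<omega>. ennreal (Z \<omega> 0))) PE (\<lambda>\<omega> t. Z \<omega> t / Z \<omega> 0)) A" .
qed simp

lemma nn_integral_Th:
  assumes [measurable]: "G \<in> borel_measurable PE"
  shows "(\<integral>\<^sup>+\<omega>. G (Th \<omega>) \<partial>M) = (\<integral>\<^sup>+\<omega>. ennreal (Z \<omega> 0) * G (\<lambda>t. Z \<omega> t / Z \<omega> 0) \<partial>M)"
proof -
  have "(\<integral>\<^sup>+\<omega>. G (Th \<omega>) \<partial>M) = (\<integral>\<^sup>+f. G f \<partial>distr M PE Th)"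
    by (rule nn_integral_distr[symmetric]) measurable
  also have "\<dots> = (\<integral>\<^sup>+\<omega>. ennreal (Z \<omega> 0) * G (\<lambda>t. Z \<omega> t / Z \<omega> 0) \<partial>M)"
    unfolding distr_Th by (simp add: nn_integral_distr nn_integral_density)
  finally show ?thesis .
qed

lemma AE_ThI:
  assumes [measurable]: "Measurable.pred PE Q"
    and "\<And>\<omega>. \<omega> \<in> space M \<Longrightarrow> 0 < Z \<omega> 0 \<Longrightarrow> Q (\<lambda>t. Z \<omega> t / Z \<omega> 0)"
  shows "AE \<omega> in M. Q (Th \<omega>)"
proof (rule AE_distrD[OF measurable_Th])
  show "AE f in distr M PE Th. Q f"
    unfolding distr_Th using assms(2)
    by (subst AE_distr_iff) (simp_all add: AE_density Collect_in_sets_PE)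
qed

lemma AE_Th_nonneg: "AE \<omega> in M. \<forall>t. 0 \<le> Th \<omega> t"
  by (rule AE_ThI) (simp_all add: Z_nonneg)

lemma AE_Th_at_0: "AE \<omega> in M. Th \<omega> 0 = 1"
  by (rule AE_ThI) simp_all

lemma AE_R_gt_1: "AE \<omega> in M. 1 < R \<omega>"
proof -
  have "prob {\<omega>\<in>space M. 1 < R \<omega>} = 1"
    using unit_pareto by (simp add: unit_pareto_def)
  then show ?thesis by (subst (asm) prob_Collect_eq_1) auto
qed

lemma distr_Th_R: "distr M PE Th \<Otimes>\<^sub>M distr M borel R = distr M (PE \<Otimes>\<^sub>M borel) (\<lambda>\<omega>. (Th \<omega>, R \<omega>))"
proof (rule pair_measure_eqI)
  show "sigma_finite_measure (distr M PE Th)" "sigma_finite_measure (distr M borel R)"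
    by (auto intro!: prob_space_imp_sigma_finite prob_space_distr)
  fix A B assume "A \<in> sets (distr M PE Th)" "B \<in> sets (distr M borel R)"
  then have [measurable]: "A \<in> sets PE" "B \<in> sets borel" by auto
  have "emeasure (distr M PE Th) A * emeasure (distr M borel R) B
      = ennreal (prob {\<omega>\<in>space M. Th \<omega> \<in> A}) * ennreal (prob {\<omega>\<in>space M. R \<omega> \<in> B})"
    by (auto simp: emeasure_distr emeasure_eq_measure
        intro!: arg_cong2[where f = "(*)"] arg_cong[where f = "\<lambda>A. ennreal (prob A)"])
  also have "\<dots> = ennreal (prob {\<omega>\<in>space M. R \<omega> \<in> B \<and> Th \<omega> \<in> A})"
    by (simp add: indep ennreal_mult mult.commute)
  also have "\<dots> = emeasure (distr M (PE \<Otimes>\<^sub>M borel) (\<lambda>\<omega>. (Th \<omega>, R \<omega>))) (A \<times> B)"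
    by (auto simp: emeasure_distr emeasure_eq_measure intro!: arg_cong[where f = prob])
  finally show "emeasure (distr M PE Th) A * emeasure (distr M borel R) B
      = emeasure (distr M (PE \<Otimes>\<^sub>M borel) (\<lambda>\<omega>. (Th \<omega>, R \<omega>))) (A \<times> B)" .
qed (auto intro!: sets_pair_measure_cong)

definition Y :: "'a \<Rightarrow> 'd field" where
  "Y \<omega> = (\<lambda>t. R \<omega> * Th \<omega> t)"

lemma measurable_Y [measurable]: "Y \<in> measurable M PE"
  unfolding Y_def
  by (intro measurable_PEI borel_measurable_times measurable_R measurable_PE_coord_compose[OF measurable_Th])

lemma nn_integral_Y:
  assumes F [measurable]: "F \<in> borel_measurable PE"
  shows "(\<integral>\<^sup>+\<omega>. F (Y \<omega>) \<partial>M) = (\<integral>\<^sup>+\<omega>. pareto_average F (Th \<omega>) \<partial>M)"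
proof -
  let ?scale = "\<lambda>(f, z) t. z * f t"
  have [measurable]: "?scale \<in> measurable (PE \<Otimes>\<^sub>M borel) (PE :: 'd field measure)"
    by (rule measurable_scaled_field[OF measurable_ident refl, unfolded id_def])
  have [measurable]: "(\<lambda>z. F (\<lambda>t. z * f t)) \<in> borel_measurable borel" for f
    by (rule measurable_compose[OF measurable_PEI F]) measurable
  interpret distr_R: prob_space "distr M borel R"
    by (rule prob_space_distr) measurable
  have "(\<integral>\<^sup>+\<omega>. F (Y \<omega>) \<partial>M) = (\<integral>\<^sup>+p. F (?scale p) \<partial>distr M (PE \<Otimes>\<^sub>M borel) (\<lambda>\<omega>. (Th \<omega>, R \<omega>)))"
    by (subst nn_integral_distr) (simp_all add: Y_def)
  also have "\<dots> = (\<integral>\<^sup>+f. \<integral>\<^sup>+z. F (?scale (f, z)) \<partial>distr M borel R \<partial>distr M PE Th)"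
    unfolding distr_Th_R[symmetric] by (rule distr_R.nn_integral_fst[symmetric]) measurable
  also have "\<dots> = (\<integral>\<^sup>+f. pareto_average F f \<partial>distr M PE Th)"
    unfolding pareto_average_def unit_pareto_distr[OF prob_space_axioms unit_pareto]
    by (intro nn_integral_cong) (simp add: nn_integral_density)
  also have "\<dots> = (\<integral>\<^sup>+\<omega>. pareto_average F (Th \<omega>) \<partial>M)"
    by (rule nn_integral_distr) measurable
  finally show ?thesis .
qed

lemma distr_Y: "distr M PE Y = tail_law"
proof (rule measure_eqI)
  fix A assume "A \<in> sets (distr M PE Y)"
  then have [measurable]: "A \<in> sets PE" by simp
  have "emeasure (distr M PE Y) A = (\<integral>\<^sup>+f. indicator A f \<partial>distr M PE Y)"
    by simp
  also have "\<dots> = (\<integral>\<^sup>+\<omega>. indicator A (Y \<omega>) \<partial>M)"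
    by (rule nn_integral_distr) measurable
  also have "\<dots> = (\<integral>\<^sup>+\<omega>. pareto_average (indicator A) (Th \<omega>) \<partial>M)"
    by (rule nn_integral_Y) measurable
  also have "\<dots> = (\<integral>\<^sup>+\<omega>. ennreal (Z \<omega> 0) * pareto_average (indicator A) (\<lambda>t. Z \<omega> t / Z \<omega> 0) \<partial>M)"
    by (rule nn_integral_Th) measurable
  also have "\<dots> = (\<integral>\<^sup>+\<omega>. \<integral>\<^sup>+z. indicator {1<..} (z * Z \<omega> 0) * indicator A (\<lambda>t. z * Z \<omega> t) \<partial>pareto_intensity \<partial>M)"
    by (intro nn_integral_cong pareto_average_normalized) (simp_all add: Z_nonneg)
  also have "\<dots> = (\<integral>\<^sup>+f. indicator {1<..} (f 0) * indicator A f \<partial>\<nu>)"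
    unfolding \<nu>_def by (rule nn_integral_exponent_measure[symmetric, OF measurable_Z]) measurable
  also have "\<dots> = (\<integral>\<^sup>+f. indicator A f \<partial>tail_law)"
    by (rule nn_integral_tail_law[symmetric]) measurable
  finally show "emeasure (distr M PE Y) A = emeasure tail_law A"
    by simp
qed simp

lemma AE_Y_iff: "Measurable.pred PE Q \<Longrightarrow> (AE \<omega> in M. Q (Y \<omega>)) \<longleftrightarrow> (AE f in tail_law. Q f)"
  unfolding distr_Y[symmetric] by (subst AE_distr_iff) (simp_all add: Collect_in_sets_PE)

lemma prob_Y:
  assumes "Measurable.pred PE Q"
  shows "prob {\<omega>\<in>space M. Q (Y \<omega>)} = measure tail_law {f. Q f}"
  unfolding distr_Y[symmetric] using Collect_in_sets_PE[OF assms]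
  by (subst measure_distr) (auto intro!: arg_cong[where f = prob])

lemma AE_Y_gt_1: "AE \<omega> in M. 1 < Y \<omega> 0"
  using AE_tail_law_gt_1 by (subst AE_Y_iff) simp_all

lemma AE_Bcnt_Y_finite_iff_Ssum_finite: "AE \<omega> in M. Bcnt (Y \<omega>) < \<top> \<longleftrightarrow> Ssum (Y \<omega>) < \<top>"
  using AE_Bcnt_finite_iff_Ssum_finite by (subst AE_Y_iff) simp_all

lemma expectation_inverse_Bcnt: "(\<integral>\<omega>. ratio_enn 1 (Bcnt (Y \<omega>)) \<partial>M) = extremal_index"
  unfolding extremal_index_eq distr_Y[symmetric] by (rule integral_distr[symmetric]) measurable

lemma expectation_Th_mass_share: "(\<integral>\<omega>. ratio_enn (Mx (Th \<omega>)) (Ssum (Th \<omega>)) \<partial>M) = extremal_index"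
proof -
  have "(\<integral>\<^sup>+\<omega>. ennreal (ratio_enn (Mx (Th \<omega>)) (Ssum (Th \<omega>))) \<partial>M)
      = (\<integral>\<^sup>+\<omega>. ennreal (Z \<omega> 0) * ennreal (ratio_enn (Mx (\<lambda>t. Z \<omega> t / Z \<omega> 0)) (Ssum (\<lambda>t. Z \<omega> t / Z \<omega> 0))) \<partial>M)"
    by (rule nn_integral_Th[of "\<lambda>f. ennreal (ratio_enn (Mx f) (Ssum f))"]) measurable
  also have "\<dots> = (\<integral>\<^sup>+\<omega>. ennreal (Z \<omega> 0 * ratio_enn (Mx (Z \<omega>)) (Ssum (Z \<omega>))) \<partial>M)"
  proof (rule nn_integral_cong)
    fix \<omega> assume \<omega>: "\<omega> \<in> space M"
    have "ratio_enn (Mx (\<lambda>t. Z \<omega> t / Z \<omega> 0)) (Ssum (\<lambda>t. Z \<omega> t / Z \<omega> 0)) = ratio_enn (Mx (Z \<omega>)) (Ssum (Z \<omega>))"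
      if "0 < Z \<omega> 0"
      using that Mx_scale[of "1 / Z \<omega> 0" "Z \<omega>"] Ssum_scale[of "1 / Z \<omega> 0" "Z \<omega>"]
      by (simp add: ratio_enn_scale)
    then show "ennreal (Z \<omega> 0) * ennreal (ratio_enn (Mx (\<lambda>t. Z \<omega> t / Z \<omega> 0)) (Ssum (\<lambda>t. Z \<omega> t / Z \<omega> 0)))
        = ennreal (Z \<omega> 0 * ratio_enn (Mx (Z \<omega>)) (Ssum (Z \<omega>)))"
      using Z_nonneg[OF \<omega>, of 0] by (cases "Z \<omega> 0 = 0") (simp_all add: ennreal_mult ratio_enn_nonneg)
  qed
  also have "\<dots> = ennreal extremal_index"
    by (rule nn_integral_Z_mass_share)
  finally show ?thesis
    by (subst integral_eq_nn_integral) (auto simp: ratio_enn_nonneg extremal_index_nonneg)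
qed

lemma extremal_index_eq_1_iff: "extremal_index = 1 \<longleftrightarrow> (\<forall>i. i \<noteq> 0 \<longrightarrow> (AE \<omega> in M. Th \<omega> i = 0))"
proof -
  let ?ratio = "\<lambda>\<omega>. ratio_enn (Mx (Th \<omega>)) (Ssum (Th \<omega>))"
  have integrable_ratio: "integrable M ?ratio"
    by (rule integrable_const_bound[where B = 1]) (auto simp: ratio_enn_nonneg ratio_enn_le_1 Mx_le_Ssum)
  have "extremal_index = 1 \<longleftrightarrow> (\<integral>\<omega>. 1 - ?ratio \<omega> \<partial>M) = 0"
    using integrable_ratio by (simp add: expectation_Th_mass_share prob_space)
  also have "\<dots> \<longleftrightarrow> (AE \<omega> in M. 1 - ?ratio \<omega> = 0)"
    using integrable_ratio by (intro integral_nonneg_eq_0_iff_AE) (auto simp: ratio_enn_le_1 Mx_le_Ssum)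
  also have "\<dots> \<longleftrightarrow> (AE \<omega> in M. \<forall>i. i \<noteq> 0 \<longrightarrow> Th \<omega> i = 0)"
  proof (rule eventually_subst)
    show "AE \<omega> in M. 1 - ?ratio \<omega> = 0 \<longleftrightarrow> (\<forall>i. i \<noteq> 0 \<longrightarrow> Th \<omega> i = 0)"
      using AE_Th_nonneg AE_Th_at_0
    proof eventually_elim
      fix \<omega> assume "\<forall>t. 0 \<le> Th \<omega> t" "Th \<omega> 0 = 1"
      then show "1 - ?ratio \<omega> = 0 \<longleftrightarrow> (\<forall>i. i \<noteq> 0 \<longrightarrow> Th \<omega> i = 0)"
        using ratio_enn_Mx_Ssum_eq_1_iff[of "Th \<omega>" 0] by auto
    qed
  qed
  also have "\<dots> \<longleftrightarrow> (\<forall>i. i \<noteq> 0 \<longrightarrow> (AE \<omega> in M. Th \<omega> i = 0))"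
    by (simp add: AE_all_countable)
  finally show ?thesis .
qed

lemma AE_anchored_if_prob_eq:
  assumes "anchoring_map I"
    and "prob {\<omega>\<in>space M. I (Y \<omega>) \<noteq> None \<and> Ssum (Y \<omega>) < \<top>} = prob {\<omega>\<in>space M. Ssum (Y \<omega>) < \<top>}"
  shows "AE \<omega> in M. Ssum (Y \<omega>) < \<top> \<longrightarrow> I (Y \<omega>) \<noteq> None"
proof -
  note [measurable] = measurable_anchoring_map[OF assms(1)]
  show ?thesis
    by (rule AE_imp_if_prob_conj_eq) (measurable, rule assms(2))
qed

lemma prob_anchor_at_0:
  assumes anchoring: "anchoring_map I" and anchored: "AE \<omega> in M. Ssum (Y \<omega>) < \<top> \<longrightarrow> I (Y \<omega>) \<noteq> None"
  shows "prob {\<omega>\<in>space M. I (Y \<omega>) = Some 0 \<and> Ssum (Y \<omega>) < \<top>} = extremal_index"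
proof -
  note [measurable] = measurable_anchoring_map[OF anchoring]
  have "AE f in tail_law. Ssum f < \<top> \<longrightarrow> I f \<noteq> None"
    using anchored by (subst (asm) AE_Y_iff[where Q = "\<lambda>f. Ssum f < \<top> \<longrightarrow> I f \<noteq> None"]) measurable
  then show ?thesis
    using measure_anchor_at_0[OF anchoring] by (subst prob_Y) simp_all
qed

lemma prob_homogeneous_anchor_at_0:
  assumes anchoring: "anchoring_map I" and homogeneous: "zero_homogeneous I"
  shows "prob {\<omega>\<in>space M. I (Th \<omega>) = Some 0 \<and> Ssum (Th \<omega>) < \<top>}
    = prob {\<omega>\<in>space M. I (Y \<omega>) = Some 0 \<and> Ssum (Y \<omega>) < \<top>}"
proof (rule measure_eq_AE)
  note [measurable] = measurable_anchoring_map[OF anchoring]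
  show "{\<omega>\<in>space M. I (Th \<omega>) = Some 0 \<and> Ssum (Th \<omega>) < \<top>} \<in> sets M"
    "{\<omega>\<in>space M. I (Y \<omega>) = Some 0 \<and> Ssum (Y \<omega>) < \<top>} \<in> sets M"
    by measurable
  show "AE \<omega> in M. \<omega> \<in> {\<omega>\<in>space M. I (Th \<omega>) = Some 0 \<and> Ssum (Th \<omega>) < \<top>}
      \<longleftrightarrow> \<omega> \<in> {\<omega>\<in>space M. I (Y \<omega>) = Some 0 \<and> Ssum (Y \<omega>) < \<top>}"
    using AE_Th_nonneg AE_R_gt_1
    by eventually_elim (use homogeneous in \<open>auto simp: zero_homogeneous_def Y_def Ssum_scale_finite_iff\<close>)
qed

lemma prob_first_exceedance_at_0:
  assumes r: "transl_inv_total_order r"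
  shows "prob {\<omega>\<in>space M. Ife r (Y \<omega>) = Some 0} = extremal_index"
proof -
  have "AE \<omega> in M. Ssum (Y \<omega>) < \<top> \<longrightarrow> Ife r (Y \<omega>) \<noteq> None"
    using AE_Y_gt_1 by eventually_elim (auto simp: Ife_def)
  note anchor = prob_anchor_at_0[OF anchoring_map_first_exceedance[OF r] this]
  have "{\<omega>\<in>space M. Ife r (Y \<omega>) = Some 0} = {\<omega>\<in>space M. Ife r (Y \<omega>) = Some 0 \<and> Ssum (Y \<omega>) < \<top>}"
    by (auto simp: Ife_def split: if_splits)
  then show ?thesis by (simp add: anchor)
qed

lemma prob_first_maximum_at_0:
  assumes r: "transl_inv_total_order r"
  shows "prob {\<omega>\<in>space M. IA r (Th \<omega>) = Some 0} = extremal_index"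
proof -
  have linear: "linear_order r"
    using r by (simp add: transl_inv_total_order_def)
  have "AE \<omega> in M. Ssum (Y \<omega>) < \<top> \<longrightarrow> IA r (Y \<omega>) \<noteq> None"
    using AE_Y_gt_1 by eventually_elim (auto simp: IA_def intro: less_trans[OF zero_less_one])
  note anchor = prob_anchor_at_0[OF anchoring_map_first_maximum[OF r] this]
  have "{\<omega>\<in>space M. IA r (Th \<omega>) = Some 0} = {\<omega>\<in>space M. IA r (Th \<omega>) = Some 0 \<and> Ssum (Th \<omega>) < \<top>}"
    by (auto simp: IA_eq_Some_iff[OF linear])
  then show ?thesis
    by (simp add: prob_homogeneous_anchor_at_0 anchoring_map_first_maximum[OF r]
        zero_homogeneous_first_maximum[OF linear] anchor)
qed

end

theorem theorem3p4:
  fixes M :: "'a measure"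
    and X Z Th Y :: "'a \<Rightarrow> int ^ 'd::finite \<Rightarrow> real"
    and R :: "'a \<Rightarrow> real"
    and r :: "((int ^ 'd) \<times> (int ^ 'd)) set"
    and I :: "(int ^ 'd \<Rightarrow> real) \<Rightarrow> (int ^ 'd) option"
  assumes "prob_space M"
    and "stationary M X"
    and "spectral_rf M X Z"
    and "spectral_tail M Z Th"
    and "unit_pareto M R"
    and "\<forall>A\<in>sets borel. \<forall>B\<in>sets PE.
           measure M {\<omega>\<in>space M. R \<omega> \<in> A \<and> Th \<omega> \<in> B}
             = measure M {\<omega>\<in>space M. R \<omega> \<in> A} * measure M {\<omega>\<in>space M. Th \<omega> \<in> B}"
    and "Y = (\<lambda>\<omega> t. R \<omega> * Th \<omega> t)"
    and "transl_inv_total_order r"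
    and "anchoring_map I"
    and "measure M {\<omega>\<in>space M. I (Y \<omega>) \<noteq> None \<and> Ssum (Y \<omega>) < \<top>}
           = measure M {\<omega>\<in>space M. Ssum (Y \<omega>) < \<top>}"
  shows "(measure M {\<omega>\<in>space M. Ssum (Th \<omega>) < \<top>} > 0 \<longrightarrow>
           ext_seq M Z \<longlonglongrightarrow> measure M {\<omega>\<in>space M. I (Y \<omega>) = Some 0 \<and> Ssum (Y \<omega>) < \<top>}
         \<and> measure M {\<omega>\<in>space M. I (Y \<omega>) = Some 0 \<and> Ssum (Y \<omega>) < \<top>}
             = measure M {\<omega>\<in>space M. Ife r (Y \<omega>) = Some 0}
         \<and> measure M {\<omega>\<in>space M. Ife r (Y \<omega>) = Some 0}
             = measure M {\<omega>\<in>space M. IA r (Th \<omega>) = Some 0}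
         \<and> measure M {\<omega>\<in>space M. IA r (Th \<omega>) = Some 0}
             = (\<integral>\<omega>. ratio_enn (Mx (Th \<omega>)) (Ssum (Th \<omega>)) \<partial>M)
         \<and> (\<integral>\<omega>. ratio_enn (Mx (Th \<omega>)) (Ssum (Th \<omega>)) \<partial>M)
             = (\<integral>\<omega>. Z \<omega> 0 * ratio_enn (Mx (Z \<omega>)) (Ssum (Z \<omega>)) \<partial>M)
         \<and> (\<integral>\<omega>. Z \<omega> 0 * ratio_enn (Mx (Z \<omega>)) (Ssum (Z \<omega>)) \<partial>M)
             = (\<integral>\<omega>. ratio_enn 1 (Bcnt (Y \<omega>)) \<partial>M)
         \<and> (zero_homogeneous I \<longrightarrow>
              ext_seq M Z \<longlonglongrightarrow> measure M {\<omega>\<in>space M. I (Th \<omega>) = Some 0 \<and> Ssum (Th \<omega>) < \<top>})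
         \<and> (AE \<omega> in M. Bcnt (Y \<omega>) < \<top> \<longleftrightarrow> Ssum (Y \<omega>) < \<top>)
         \<and> (ext_seq M Z \<longlonglongrightarrow> 1 \<longleftrightarrow> (\<forall>i. i \<noteq> 0 \<longrightarrow> (AE \<omega> in M. Th \<omega> i = 0))))
       \<and> ext_seq M Z \<longlonglongrightarrow> (\<integral>\<omega>. ratio_enn 1 (Bcnt (Y \<omega>)) \<partial>M)"
proof -
  interpret prob_space M by fact
  interpret max_stable_tail M X Z Th R
    using assms(2-6) by unfold_locales auto
  have Y: "Y = max_stable_tail.Y Th R"
    unfolding assms(7) by (simp add: fun_eq_iff Y_def)
  have limit_iff: "ext_seq M Z \<longlonglongrightarrow> 1 \<longleftrightarrow> extremal_index = 1"
    using ext_seq_tendsto LIMSEQ_unique by metis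
  have anchor: "measure M {\<omega>\<in>space M. I (Y \<omega>) = Some 0 \<and> Ssum (Y \<omega>) < \<top>} = extremal_index"
    unfolding Y using assms(9,10) by (intro prob_anchor_at_0 AE_anchored_if_prob_eq) (simp_all add: Y)
  have homogeneous_anchor: "measure M {\<omega>\<in>space M. I (Th \<omega>) = Some 0 \<and> Ssum (Th \<omega>) < \<top>} = extremal_index"
    if "zero_homogeneous I"
    using prob_homogeneous_anchor_at_0[OF assms(9) that] anchor by (simp add: Y)
  show ?thesis
    unfolding anchor expectation_Th_mass_share expectation_Z_mass_share prob_first_maximum_at_0[OF assms(8)]
      limit_iff extremal_index_eq_1_iff
    unfolding Y expectation_inverse_Bcnt prob_first_exceedance_at_0[OF assms(8)]
    using ext_seq_tendsto AE_Bcnt_Y_finite_iff_Ssum_finite homogeneous_anchor by simp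
qed

end
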